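(* The group $W_3(\mathbb Z)=\mathbb Z\wr(\mathbb Z\wr\mathbb Z)$ is isomorphic to a subgroup of $\mathcal F_2$, the group of finite-state automorphisms of the binary rooted tree. Consequently $\mathbb Z\wr(\mathbb Z\wr\mathbb Z)$ is a subgroup of an automata group acting on the binary tree.
   Context: Wreath products are restricted wreath products with the regular action. For $m\ge2$, $\mathcal T_m$ is the one-rooted $m$-regular tree with vertices the finite words over $\{1,\dots,m\}$, $\mathcal A_m$ its automorphism group, each $\alpha\in\mathcal A_m$ written $\alpha=(\alpha_1,\dots,\alpha_m)\sigma(\alpha)$ with $\sigma(\alpha)\in S_m$ the first-level action and $\alpha_i$ the states; $Q(\alpha)=\{\alpha\}\cup\bigcup_iQ(\alpha_i)$, $\alpha$ is finite-state if $Q(\alpha)$ is finite, and $\mathcal F_m$ is the group of finite-state automorphisms. A subgroup $G\le\mathcal A_m$ is self-similar if $Q(\alpha)\subseteq G$ for all $\alpha\in G$; an automata group is a finitely generated self-similar subgroup of some $\mathcal F_m$. *)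

theory Defs
  imports "HOL-Algebra.Algebra"
begin

text \<open>A \<wr> H = (finitely supported functions carrier H \<rightarrow> carrier A) \<rtimes> H,
  where h acts on f by (h . f)(x) = f(h^-1 x). Functions are extensional (value one A
  outside carrier H).\<close>

definition wreath :: "('a, 'c) monoid_scheme \<Rightarrow> ('b, 'd) monoid_scheme \<Rightarrow> (('b \<Rightarrow> 'a) \<times> 'b) monoid" where
  "wreath A H = \<lparr>
     carrier = {(f, h). f \<in> carrier H \<rightarrow> carrier A
                      \<and> (\<forall>x. x \<notin> carrier H \<longrightarrow> f x = \<one>\<^bsub>A\<^esub>)
                      \<and> finite {x \<in> carrier H. f x \<noteq> \<one>\<^bsub>A\<^esub>}
                      \<and> h \<in> carrier H},
     monoid.mult = (\<lambda>(f, h) (g, k).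
        ((\<lambda>x. if x \<in> carrier H then f x \<otimes>\<^bsub>A\<^esub> g (inv\<^bsub>H\<^esub> h \<otimes>\<^bsub>H\<^esub> x) else \<one>\<^bsub>A\<^esub>),
         h \<otimes>\<^bsub>H\<^esub> k)),
     one = ((\<lambda>x. \<one>\<^bsub>A\<^esub>), \<one>\<^bsub>H\<^esub>) \<rparr>"

definition W3 :: "((((int \<Rightarrow> int) \<times> int) \<Rightarrow> int) \<times> ((int \<Rightarrow> int) \<times> int)) monoid" where
  "W3 = wreath integer_group (wreath integer_group integer_group)"

definition words :: "nat \<Rightarrow> nat list set" where
  "words m = {w. set w \<subseteq> {1..m}}"

definition tree_aut :: "nat \<Rightarrow> (nat list \<Rightarrow> nat list) \<Rightarrow> bool" where
  "tree_aut m \<alpha> \<longleftrightarrow>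
     bij_betw \<alpha> (words m) (words m)
   \<and> (\<forall>w \<in> words m. length (\<alpha> w) = length w)
   \<and> (\<forall>u \<in> words m. \<forall>v \<in> words m. (\<exists>z. v = u @ z) \<longleftrightarrow> (\<exists>z. \<alpha> v = \<alpha> u @ z))
   \<and> (\<forall>w. w \<notin> words m \<longrightarrow> \<alpha> w = w)"

definition Aut :: "nat \<Rightarrow> (nat list \<Rightarrow> nat list) monoid" where
  "Aut m = \<lparr> carrier = {\<alpha>. tree_aut m \<alpha>}, monoid.mult = (\<circ>), one = id \<rparr>"

text \<open>The state (section) of \<alpha> at vertex v: \<alpha>(v w) = \<alpha>(v) \<alpha>_v(w).\<close>
definition state :: "nat \<Rightarrow> (nat list \<Rightarrow> nat list) \<Rightarrow> nat list \<Rightarrow> (nat list \<Rightarrow> nat list)" where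
  "state m \<alpha> v = (\<lambda>w. if w \<in> words m then drop (length v) (\<alpha> (v @ w)) else w)"

text \<open>Q(\<alpha>) = {\<alpha>} \<union> \<Union>_i Q(\<alpha>_i), i.e. the set of all states of \<alpha> at all vertices.\<close>
definition states :: "nat \<Rightarrow> (nat list \<Rightarrow> nat list) \<Rightarrow> (nat list \<Rightarrow> nat list) set" where
  "states m \<alpha> = state m \<alpha> ` words m"

definition finite_state :: "nat \<Rightarrow> (nat list \<Rightarrow> nat list) \<Rightarrow> bool" where
  "finite_state m \<alpha> \<longleftrightarrow> finite (states m \<alpha>)"

definition FA :: "nat \<Rightarrow> (nat list \<Rightarrow> nat list) monoid" where
  "FA m = (Aut m)\<lparr> carrier := {\<alpha> \<in> carrier (Aut m). finite_state m \<alpha>} \<rparr>"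

definition self_similar :: "nat \<Rightarrow> (nat list \<Rightarrow> nat list) set \<Rightarrow> bool" where
  "self_similar m G \<longleftrightarrow> (\<forall>\<alpha> \<in> G. states m \<alpha> \<subseteq> G)"

definition automata_group :: "nat \<Rightarrow> (nat list \<Rightarrow> nat list) set \<Rightarrow> bool" where
  "automata_group m G \<longleftrightarrow>
     subgroup G (FA m)
   \<and> (\<exists>S. finite S \<and> S \<subseteq> carrier (FA m) \<and> generate (FA m) S = G)
   \<and> self_similar m G"

end

theory Submission
  imports Defs
begin

text \<open>
  If a group \<open>H\<close> acts on a set \<open>\<Omega>\<close> and \<open>c\<close> maps \<open>\<Omega>\<close> to the 2-adic integers, then \<open>\<int> \<wr> H\<close> acts on
  triples \<open>(p, x, t)\<close> with \<open>p\<close> a binary mask and \<open>t\<close> a 2-adic integer: \<open>H\<close> moves \<open>x\<close>, and the lamp at \<open>1\<close>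
  adds to \<open>t\<close> the number \<open>c x\<close> with its digits masked by \<open>p\<close>. Additions commute, so only
  independence of the translates of \<open>c\<close> over the integers is needed for faithfulness; if \<open>H\<close>, \<open>p\<close>, \<open>x\<close>
  and \<open>t\<close> live on interleaved binary digits and \<open>c\<close> is computed by a finite automaton, the action is
  by finite-state automorphisms of the binary tree.

  The construction is applied twice. First \<open>\<int>\<close> acts on pairs \<open>(r, u)\<close> of power series over the field
  with two elements by multiplying \<open>u\<close> with \<open>1 + X\<close>, and \<open>c (r, u) = u\<close> with mask \<open>s\<close>. The digits of
  \<open>(1 + X)\<^sup>e\<close> are binomial coefficients modulo 2, which form a unitriangular matrix; hence for finitely
  many nontrivial elements of \<open>\<int> \<wr> \<int>\<close> there are \<open>r\<close> and \<open>s\<close> such that all of them move the point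
  \<open>(s, (r, r), 0)\<close> out of the closed set of points \<open>(s, (r, u), v)\<close> with \<open>u = r\<close> and \<open>v = 0\<close>. The
  second \<open>c\<close> has digit 1 as long as a point looks like a point of this set. Outside the set only
  finitely many digits are 1, so a mask selecting a later digit isolates a single lamp.
\<close>

type_synonym bits = "nat \<Rightarrow> bool"

section \<open>Restricted wreath products\<close>

lemma wreath_carrier_iff:
  "(f, h) \<in> carrier (wreath A H) \<longleftrightarrow> f \<in> carrier H \<rightarrow> carrier A
     \<and> (\<forall>x. x \<notin> carrier H \<longrightarrow> f x = \<one>\<^bsub>A\<^esub>) \<and> finite {x \<in> carrier H. f x \<noteq> \<one>\<^bsub>A\<^esub>} \<and> h \<in> carrier H"
  by (simp add: wreath_def)

lemma wreath_mult:
  "(f, h) \<otimes>\<^bsub>wreath A H\<^esub> (g, k) =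
     ((\<lambda>x. if x \<in> carrier H then f x \<otimes>\<^bsub>A\<^esub> g (inv\<^bsub>H\<^esub> h \<otimes>\<^bsub>H\<^esub> x) else \<one>\<^bsub>A\<^esub>), h \<otimes>\<^bsub>H\<^esub> k)"
  by (simp add: wreath_def)

lemma wreath_one: "\<one>\<^bsub>wreath A H\<^esub> = ((\<lambda>x. \<one>\<^bsub>A\<^esub>), \<one>\<^bsub>H\<^esub>)"
  by (simp add: wreath_def)

lemma group_wreath:
  assumes A: "group A" and H: "group H"
  shows "group (wreath A H)"
proof -
  interpret A: group A by fact
  interpret H: group H by fact
  have fin: "finite {x \<in> carrier H. g (inv\<^bsub>H\<^esub> h \<otimes>\<^bsub>H\<^esub> x) \<noteq> \<one>\<^bsub>A\<^esub>}"
    if "finite {x \<in> carrier H. g x \<noteq> \<one>\<^bsub>A\<^esub>}" "h \<in> carrier H" for g h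
  proof (rule finite_subset[OF _ finite_imageI[OF that(1), of "\<lambda>x. h \<otimes>\<^bsub>H\<^esub> x"]], rule subsetI)
    fix x assume x: "x \<in> {x \<in> carrier H. g (inv\<^bsub>H\<^esub> h \<otimes>\<^bsub>H\<^esub> x) \<noteq> \<one>\<^bsub>A\<^esub>}"
    then have "x = h \<otimes>\<^bsub>H\<^esub> (inv\<^bsub>H\<^esub> h \<otimes>\<^bsub>H\<^esub> x)"
      using that by (simp add: H.m_assoc[symmetric])
    with x that show "x \<in> (\<lambda>x. h \<otimes>\<^bsub>H\<^esub> x) ` {x \<in> carrier H. g x \<noteq> \<one>\<^bsub>A\<^esub>}"
      by (intro image_eqI) auto
  qed
  show ?thesis
  proof (rule groupI, goal_cases)
    case (1 a b)
    obtain f h g k where [simp]: "a = (f, h)" "b = (g, k)" by (cases a; cases b)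
    have fs: "f \<in> carrier H \<rightarrow> carrier A" "finite {x \<in> carrier H. f x \<noteq> \<one>\<^bsub>A\<^esub>}" "h \<in> carrier H"
      "g \<in> carrier H \<rightarrow> carrier A" "finite {x \<in> carrier H. g x \<noteq> \<one>\<^bsub>A\<^esub>}" "k \<in> carrier H"
      using 1 by (auto simp: wreath_carrier_iff)
    have "finite ({x \<in> carrier H. f x \<noteq> \<one>\<^bsub>A\<^esub>} \<union> {x \<in> carrier H. g (inv\<^bsub>H\<^esub> h \<otimes>\<^bsub>H\<^esub> x) \<noteq> \<one>\<^bsub>A\<^esub>})"
      using fs fin by blast
    then have "finite {x \<in> carrier H. f x \<otimes>\<^bsub>A\<^esub> g (inv\<^bsub>H\<^esub> h \<otimes>\<^bsub>H\<^esub> x) \<noteq> \<one>\<^bsub>A\<^esub>}"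
      by (rule rev_finite_subset) auto
    then show ?case
      using fs by (auto simp: wreath_mult wreath_carrier_iff Pi_iff cong: conj_cong)
  next
    case 2
    show ?case by (simp add: wreath_one wreath_carrier_iff)
  next
    case (3 a b c)
    obtain f h g k e l where [simp]: "a = (f, h)" "b = (g, k)" "c = (e, l)"
      by (cases a; cases b; cases c)
    show ?case
      using 3 by (auto simp: wreath_mult wreath_carrier_iff Pi_iff A.m_assoc H.m_assoc
          H.inv_mult_group intro!: ext)
  next
    case (4 a)
    then show ?case
      by (cases a) (auto simp: wreath_mult wreath_one wreath_carrier_iff Pi_iff)
  next
    case (5 a)
    obtain f h where [simp]: "a = (f, h)" by (cases a)
    have fs: "f \<in> carrier H \<rightarrow> carrier A" "finite {x \<in> carrier H. f x \<noteq> \<one>\<^bsub>A\<^esub>}" "h \<in> carrier H"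
      using 5 by (auto simp: wreath_carrier_iff)
    let ?b = "((\<lambda>x. if x \<in> carrier H then inv\<^bsub>A\<^esub> f (h \<otimes>\<^bsub>H\<^esub> x) else \<one>\<^bsub>A\<^esub>), inv\<^bsub>H\<^esub> h)"
    have "finite {x \<in> carrier H. f (h \<otimes>\<^bsub>H\<^esub> x) \<noteq> \<one>\<^bsub>A\<^esub>}"
      using fin[OF fs(2), of "inv\<^bsub>H\<^esub> h"] fs by simp
    then have "finite {x \<in> carrier H. inv\<^bsub>A\<^esub> f (h \<otimes>\<^bsub>H\<^esub> x) \<noteq> \<one>\<^bsub>A\<^esub>}"
      by (rule rev_finite_subset) auto
    then have "?b \<in> carrier (wreath A H)"
      using fs by (auto simp: wreath_carrier_iff Pi_iff cong: conj_cong)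
    moreover have "?b \<otimes>\<^bsub>wreath A H\<^esub> a = \<one>\<^bsub>wreath A H\<^esub>"
      using fs by (auto simp: wreath_mult wreath_one Pi_iff intro!: ext)
    ultimately show ?case by blast
  qed
qed

section \<open>Generators of a wreath product with the integers\<close>

definition lamp :: "('b, 'd) monoid_scheme \<Rightarrow> ('b \<Rightarrow> int) \<times> 'b" where
  "lamp H = ((\<lambda>x. if x = \<one>\<^bsub>H\<^esub> then 1 else 0), \<one>\<^bsub>H\<^esub>)"

definition cursor :: "'b \<Rightarrow> ('b \<Rightarrow> int) \<times> 'b" where
  "cursor h = ((\<lambda>x. 0), h)"

lemma generate_integer_group: "generate integer_group {1} = UNIV"
proof -
  interpret group integer_group by (rule group_integer_group)
  show ?thesis
    by (subst generate_pow) auto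
qed

lemma (in group) lamp_in_carrier: "lamp G \<in> carrier (wreath integer_group G)"
  by (auto simp: lamp_def wreath_carrier_iff)

lemma (in group) cursor_in_carrier: "h \<in> carrier G \<Longrightarrow> cursor h \<in> carrier (wreath integer_group G)"
  by (auto simp: cursor_def wreath_carrier_iff)

text \<open>The point mass \<open>n\<close> at \<open>y\<close> is the conjugate by
  \<open>cursor y\<close> of the \<open>n\<close>-th power of the lamp. A finitely supported
  function is a product of point masses, and every element is such a function times a
  cursor.\<close>

lemma (in group) generate_wreath:
  assumes S: "S \<subseteq> carrier G" and gen: "generate G S = carrier G"
  shows "generate (wreath integer_group G) (insert (lamp G) (cursor ` S)) = carrier (wreath integer_group G)"
    (is "?N = carrier ?W")
proof
  interpret W: group ?W by (rule group_wreath[OF group_integer_group is_group])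
  let ?S = "insert (lamp G) (cursor ` S)"
  have S': "?S \<subseteq> carrier ?W"
    using S lamp_in_carrier cursor_in_carrier by auto
  show "?N \<subseteq> carrier ?W" by (rule W.generate_incl[OF S'])
  have N: "subgroup ?N ?W" by (rule W.generate_is_subgroup[OF S'])
  have "group_hom G ?W cursor"
    by (auto simp: group_hom_def group_hom_axioms_def is_group W.is_group hom_def
        cursor_in_carrier cursor_def wreath_mult wreath_carrier_iff)
  from group_hom.generate_img[OF this S] have "cursor ` carrier G = generate ?W (cursor ` S)"
    using gen by simp
  also have "\<dots> \<subseteq> ?N" by (rule W.mono_generate) auto
  finally have cursor: "cursor h \<in> ?N" if "h \<in> carrier G" for h using that by blast
  let ?d = "\<lambda>y n. ((\<lambda>x. if x = y then n else 0), \<one>)"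
  have d: "?d y n \<in> ?N" if y: "y \<in> carrier G" for y and n :: int
  proof -
    have "?d \<one> n = lamp G [^]\<^bsub>?W\<^esub> n" for n :: int
    proof -
      have hom: "(\<lambda>n. ?d \<one> n) \<in> hom integer_group ?W"
        by (auto simp: hom_def wreath_carrier_iff wreath_mult)
      interpret group_hom integer_group ?W "\<lambda>n. ?d \<one> n"
        by (rule group_hom.intro) (auto simp: group_hom_axioms_def hom W.is_group)
      show ?thesis
        using hom_int_pow[of 1 n] by (simp add: lamp_def cong: if_cong)
    qed
    then have "?d \<one> n \<in> ?N"
      by (metis W.subgroup_int_pow_closed[OF N] generate.incl insertI1)
    moreover have "?d y n = cursor y \<otimes>\<^bsub>?W\<^esub> (?d \<one> n \<otimes>\<^bsub>?W\<^esub> cursor (inv y))"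
      using y inv_comm inv_equality by (fastforce simp: cursor_def wreath_mult intro!: ext)
    ultimately show ?thesis
      using cursor[OF y] cursor[of "inv y"] y by (simp add: subgroup.m_closed[OF N])
  qed
  \<comment> \<open>The induction is over a finite superset \<open>K\<close> of the support, so each
    step only has to split off the value at one point of \<open>K\<close>, which may be
    zero.\<close>
  have base: "(f, \<one>) \<in> ?N" if "finite K" "(f, \<one>) \<in> carrier ?W" "{x \<in> carrier G. f x \<noteq> 0} \<subseteq> K"
    for K f
    using that
  proof (induction K arbitrary: f rule: finite_induct)
    case empty
    then have "(f, \<one>) = \<one>\<^bsub>?W\<^esub>"
      by (auto simp: wreath_carrier_iff wreath_one)
    then show ?case using subgroup.one_closed[OF N] by metis
  next
    case (insert y K)
    show ?case
    proof (cases "y \<in> carrier G")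
      case False
      then show ?thesis using insert.IH[of f] insert.prems by blast
    next
      case True
      let ?g = "\<lambda>x. if x = y then 0 else f x"
      have "finite {x \<in> carrier G. ?g x \<noteq> 0}"
        using insert.hyps(1) insert.prems(2) by (rule_tac finite_subset[of _ K]) auto
      then have "(?g, \<one>) \<in> ?N"
        using insert.prems insert.hyps by (intro insert.IH) (auto simp: wreath_carrier_iff)
      moreover have "(f, \<one>) = ?d y (f y) \<otimes>\<^bsub>?W\<^esub> (?g, \<one>)"
        using insert.prems True by (auto simp: wreath_mult wreath_carrier_iff intro!: ext)
      ultimately show ?thesis
        using subgroup.m_closed[OF N d[OF True]] by simp
    qed
  qed
  show "carrier ?W \<subseteq> ?N"
  proof
    fix a assume a: "a \<in> carrier ?W"
    obtain f h where [simp]: "a = (f, h)" by (cases a)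
    have "h \<in> carrier G" using a by (simp add: wreath_carrier_iff)
    moreover have "(f, \<one>) \<in> ?N"
      using a by (intro base[of "{x \<in> carrier G. f x \<noteq> 0}"]) (auto simp: wreath_carrier_iff)
    moreover have "a = (f, \<one>) \<otimes>\<^bsub>?W\<^esub> cursor h"
      using a by (auto simp: wreath_mult wreath_carrier_iff cursor_def intro!: ext)
    ultimately show "a \<in> ?N"
      using cursor by (simp add: subgroup.m_closed[OF N])
  qed
qed

section \<open>Automorphisms of regular rooted trees and their states\<close>

lemma words_append: "u @ v \<in> words m \<longleftrightarrow> u \<in> words m \<and> v \<in> words m"
  by (auto simp: words_def)

lemma Nil_in_words: "[] \<in> words m"
  by (simp add: words_def)

text \<open>Since \<open>\<alpha>\<close> is the identity off \<open>words m\<close>, bijectivity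
  and length can be stated on all lists. Preserving prefixes suffices: if \<open>\<alpha> u\<close>
  is a prefix of \<open>\<alpha> v\<close>, then \<open>u\<close> and the prefix of \<open>v\<close>
  of the same length have equal images, hence are equal.\<close>

lemma tree_aut_iff:
  "tree_aut m \<alpha> \<longleftrightarrow> bij \<alpha> \<and> (\<forall>w. length (\<alpha> w) = length w)
     \<and> (\<forall>u v. u @ v \<in> words m \<longrightarrow> (\<exists>z. \<alpha> (u @ v) = \<alpha> u @ z)) \<and> (\<forall>w. w \<notin> words m \<longrightarrow> \<alpha> w = w)"
  (is "?L \<longleftrightarrow> ?R")
proof
  assume L: ?L
  then have "bij_betw \<alpha> (words m \<union> - words m) (words m \<union> - words m)"
    by (intro bij_betw_combine) (auto simp: tree_aut_def intro: bij_betw_cong[THEN iffD2, OF _ bij_betw_id])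
  then show ?R using L
    unfolding tree_aut_def by (metis Compl_partition words_append)
next
  assume R: ?R
  then have mem: "\<alpha> w \<in> words m \<longleftrightarrow> w \<in> words m" for w
    by (metis bij_def injD)
  have "bij_betw \<alpha> (words m) (words m)"
    unfolding bij_betw_def
  proof
    show "inj_on \<alpha> (words m)" using R by (meson bij_def inj_on_subset subset_UNIV)
    show "\<alpha> ` words m = words m"
      using R mem by (auto simp: image_iff) (metis bij_pointE)
  qed
  moreover have "\<exists>z. v = u @ z" if uv: "u \<in> words m" "v \<in> words m" "\<alpha> v = \<alpha> u @ z" for u v z
  proof -
    obtain y where y: "\<alpha> v = \<alpha> (take (length u) v) @ y"
      using R uv by (metis append_take_drop_id)
    have "length v = length u + length z"
      using R arg_cong[OF uv(3), of length] by simp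
    then have "\<alpha> (take (length u) v) = \<alpha> u"
      using y R uv(3) by (metis append_eq_append_conv length_take min_absorb2 le_add1)
    then have "take (length u) v = u"
      using R by (meson bij_def injD)
    then show ?thesis by (metis append_take_drop_id)
  qed
  ultimately show ?L
    using R unfolding tree_aut_def by blast
qed

lemma tree_aut_prefix:
  "tree_aut m \<alpha> \<Longrightarrow> u \<in> words m \<Longrightarrow> v \<in> words m \<Longrightarrow> (\<exists>z. v = u @ z) \<longleftrightarrow> (\<exists>z. \<alpha> v = \<alpha> u @ z)"
  by (simp only: tree_aut_def)

lemma tree_aut_mem: "tree_aut m \<alpha> \<Longrightarrow> \<alpha> w \<in> words m \<longleftrightarrow> w \<in> words m"
  by (metis bij_betwE tree_aut_def)

lemma tree_aut_append:
  assumes "tree_aut m \<alpha>" "v \<in> words m" "w \<in> words m"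
  shows "\<alpha> (v @ w) = \<alpha> v @ state m \<alpha> v w"
proof -
  obtain z where "\<alpha> (v @ w) = \<alpha> v @ z"
    using assms(1)[unfolded tree_aut_iff] assms(2,3) words_append[of v w m] by blast
  moreover have "length (\<alpha> v) = length v" using assms by (simp add: tree_aut_iff)
  ultimately show ?thesis using assms by (simp add: state_def)
qed

lemma length_state: "tree_aut m \<alpha> \<Longrightarrow> length (state m \<alpha> v w) = length w"
  by (simp add: state_def tree_aut_iff)

lemma state_mem:
  assumes "tree_aut m \<alpha>" "v \<in> words m"
  shows "state m \<alpha> v w \<in> words m \<longleftrightarrow> w \<in> words m"
proof (cases "w \<in> words m")
  case True
  then have "\<alpha> (v @ w) \<in> words m"
    using assms by (simp add: tree_aut_mem words_append)
  then show ?thesis using True assms by (simp add: tree_aut_append words_append)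
qed (simp add: state_def)

lemma state_eqI:
  assumes "tree_aut m \<alpha>" "v \<in> words m"
    and "\<And>w. w \<in> words m \<Longrightarrow> \<alpha> (v @ w) = \<alpha> v @ f w" "\<And>w. w \<notin> words m \<Longrightarrow> f w = w"
  shows "state m \<alpha> v = f"
proof
  fix w show "state m \<alpha> v w = f w"
    using assms tree_aut_append[of m \<alpha> v w] by (cases "w \<in> words m") (auto simp: state_def)
qed

lemma tree_aut_state:
  assumes "tree_aut m \<alpha>" and v: "v \<in> words m"
  shows "tree_aut m (state m \<alpha> v)"
  unfolding tree_aut_iff
proof (intro conjI allI impI)
  note app = tree_aut_append[OF assms]
  have bij: "bij \<alpha>" using assms by (simp add: tree_aut_iff)
  have "w = w'" if eq: "state m \<alpha> v w = state m \<alpha> v w'" for w w'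
  proof (cases "w \<in> words m")
    case True
    then have "w' \<in> words m" using eq state_mem[OF assms, of w] state_mem[OF assms, of w'] by simp
    then have "\<alpha> (v @ w) = \<alpha> (v @ w')" using True eq app by simp
    then show ?thesis using injD[OF bij_is_inj[OF bij]] by blast
  next
    case False
    then have "w' \<notin> words m" using eq state_mem[OF assms, of w] state_mem[OF assms, of w'] by simp
    then show ?thesis using False eq by (simp add: state_def)
  qed
  moreover have "\<exists>w. y = state m \<alpha> v w" for y
  proof (cases "y \<in> words m")
    case True
    \<comment> \<open>Prefix relations are also reflected, so a preimage of
      \<open>\<alpha> v @ y\<close> extends \<open>v\<close>, and what follows \<open>v\<close> in
      it is the preimage of \<open>y\<close> under the state.\<close>
    obtain x where x: "\<alpha> x = \<alpha> v @ y" using bij_is_surj[OF bij] by (metis surjD)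
    then have "\<alpha> x \<in> words m" using True assms by (simp add: tree_aut_mem words_append)
    then have "x \<in> words m" using assms by (simp add: tree_aut_mem)
    then obtain w where w: "x = v @ w"
      using x tree_aut_prefix[OF assms] by auto
    then have "y = state m \<alpha> v w"
      using x app \<open>x \<in> words m\<close> by (simp add: words_append)
    then show ?thesis ..
  qed (auto simp: state_def)
  ultimately show "bij (state m \<alpha> v)"
    unfolding bij_def inj_def surj_def by blast
  show "length (state m \<alpha> v w) = length w" for w
    by (rule length_state[OF assms(1)])
  show "state m \<alpha> v w = w" if "w \<notin> words m" for w
    using that by (simp add: state_def)
  show "\<exists>z. state m \<alpha> v (u @ w) = state m \<alpha> v u @ z" if "u @ w \<in> words m" for u w
  proof -
    have uw: "u \<in> words m" "w \<in> words m" "v @ u \<in> words m"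
      using that v by (auto simp: words_append)
    have "\<alpha> v @ state m \<alpha> v (u @ w) = \<alpha> (v @ u) @ state m \<alpha> (v @ u) w"
      using app[OF that] tree_aut_append[OF assms(1) uw(3) uw(2)] by simp
    then show ?thesis using app[OF uw(1)] by simp
  qed
qed

lemma state_append:
  assumes "tree_aut m \<alpha>" "v \<in> words m" "w \<in> words m"
  shows "state m (state m \<alpha> v) w = state m \<alpha> (v @ w)"
proof (rule state_eqI[OF tree_aut_state])
  fix x assume "x \<in> words m"
  then show "state m \<alpha> v (w @ x) = state m \<alpha> v w @ state m \<alpha> (v @ w) x"
    using assms tree_aut_append[of m \<alpha> v w] tree_aut_append[of m \<alpha> v "w @ x"]
      tree_aut_append[of m \<alpha> "v @ w" x]
    by (simp add: words_append)
qed (use assms in \<open>auto simp: state_def\<close>)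

lemma self_in_states:
  assumes "tree_aut m \<alpha>"
  shows "\<alpha> \<in> states m \<alpha>"
proof -
  have "length (\<alpha> []) = 0" using assms by (simp add: tree_aut_iff)
  then have "\<alpha> = state m \<alpha> []"
    using assms by (intro state_eqI[symmetric]) (auto simp: Nil_in_words tree_aut_iff)
  then show ?thesis unfolding states_def by (rule image_eqI) (rule Nil_in_words)
qed

lemma tree_aut_id: "tree_aut m id"
  by (auto simp: tree_aut_iff)

lemma tree_aut_comp:
  assumes "tree_aut m \<alpha>" "tree_aut m \<beta>"
  shows "tree_aut m (\<alpha> \<circ> \<beta>)"
  unfolding tree_aut_iff
proof (intro conjI allI impI)
  show "bij (\<alpha> \<circ> \<beta>)" using assms by (simp add: tree_aut_iff bij_comp)
  show "\<exists>z. (\<alpha> \<circ> \<beta>) (u @ v) = (\<alpha> \<circ> \<beta>) u @ z" if "u @ v \<in> words m" for u v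
    using that assms by (auto simp: words_append tree_aut_append state_mem tree_aut_mem)
qed (use assms in \<open>auto simp: tree_aut_iff\<close>)

lemma state_comp:
  assumes "tree_aut m \<alpha>" "tree_aut m \<beta>" "v \<in> words m"
  shows "state m (\<alpha> \<circ> \<beta>) v = state m \<alpha> (\<beta> v) \<circ> state m \<beta> v"
proof (rule state_eqI[OF tree_aut_comp[OF assms(1,2)] assms(3)])
  fix w assume "w \<in> words m"
  then show "(\<alpha> \<circ> \<beta>) (v @ w) = (\<alpha> \<circ> \<beta>) v @ (state m \<alpha> (\<beta> v) \<circ> state m \<beta> v) w"
    using assms by (simp add: tree_aut_append state_mem tree_aut_mem)
qed (simp add: state_def)

lemma state_id: "v \<in> words m \<Longrightarrow> state m id v = id"
  by (rule state_eqI[OF tree_aut_id]) auto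

lemma tree_aut_inv:
  assumes "tree_aut m \<alpha>"
  shows "tree_aut m (inv_into UNIV \<alpha>)"
proof -
  have bij: "bij \<alpha>" and len: "\<And>w. length (\<alpha> w) = length w" using assms by (auto simp: tree_aut_iff)
  have \<alpha>: "\<alpha> (inv_into UNIV \<alpha> w) = w" for w using bij by (simp add: bij_is_surj surj_f_inv_f)
  have len': "length (inv_into UNIV \<alpha> w) = length w" for w
    using len[of "inv_into UNIV \<alpha> w"] by (simp add: \<alpha>)
  have mem: "inv_into UNIV \<alpha> w \<in> words m \<longleftrightarrow> w \<in> words m" for w
    using tree_aut_mem[OF assms, of "inv_into UNIV \<alpha> w"] by (simp add: \<alpha>)
  have "\<exists>z. inv_into UNIV \<alpha> (u @ v) = inv_into UNIV \<alpha> u @ z" if "u @ v \<in> words m" for u v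
  proof -
    have "inv_into UNIV \<alpha> u \<in> words m" "inv_into UNIV \<alpha> (u @ v) \<in> words m"
      using that by (auto simp: mem words_append)
    moreover have "\<alpha> (inv_into UNIV \<alpha> (u @ v)) = \<alpha> (inv_into UNIV \<alpha> u) @ v" by (simp add: \<alpha>)
    ultimately show ?thesis using tree_aut_prefix[OF assms] by blast
  qed
  moreover have "inv_into UNIV \<alpha> w = w" if "w \<notin> words m" for w
    using that assms bij by (metis bij_is_inj inv_f_f tree_aut_def)
  ultimately show ?thesis
    using bij len' by (simp add: tree_aut_iff bij_imp_bij_inv)
qed

text \<open>Taking states on both sides of
  \<open>\<alpha> \<circ> inv_into UNIV \<alpha> = id\<close> shows that the state of the inverse at
  \<open>v\<close> inverts the state of \<open>\<alpha>\<close> at the preimage of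
  \<open>v\<close>.\<close>

lemma state_inv:
  assumes "tree_aut m \<alpha>" "v \<in> words m"
  shows "state m (inv_into UNIV \<alpha>) v = inv_into UNIV (state m \<alpha> (inv_into UNIV \<alpha> v))"
proof -
  have inv: "tree_aut m (inv_into UNIV \<alpha>)" using assms(1) by (rule tree_aut_inv)
  then have mem: "inv_into UNIV \<alpha> v \<in> words m" using assms(2) by (simp add: tree_aut_mem)
  have "\<alpha> \<circ> inv_into UNIV \<alpha> = id"
    using assms(1) by (metis bij_is_surj surj_iff tree_aut_iff)
  then have "state m \<alpha> (inv_into UNIV \<alpha> v) \<circ> state m (inv_into UNIV \<alpha>) v = id"
    using state_comp[OF assms(1) inv assms(2)] assms(2) by (simp add: state_id)
  moreover have "bij (state m \<alpha> (inv_into UNIV \<alpha> v))"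
    using tree_aut_state[OF assms(1) mem] by (simp add: tree_aut_iff)
  ultimately show ?thesis
    by (metis bij_is_inj comp_assoc id_comp inv_o_cancel comp_id)
qed

section \<open>The group of finite-state automorphisms\<close>

lemma FA_simps:
  "\<alpha> \<in> carrier (FA m) \<longleftrightarrow> tree_aut m \<alpha> \<and> finite_state m \<alpha>"
  "\<alpha> \<otimes>\<^bsub>FA m\<^esub> \<beta> = \<alpha> \<circ> \<beta>"
  "\<one>\<^bsub>FA m\<^esub> = id"
  by (auto simp: FA_def Aut_def)

lemma finite_state_comp:
  assumes "tree_aut m \<alpha>" "tree_aut m \<beta>" "finite_state m \<alpha>" "finite_state m \<beta>"
  shows "finite_state m (\<alpha> \<circ> \<beta>)"
proof -
  have "states m (\<alpha> \<circ> \<beta>) \<subseteq> (\<lambda>(a, b). a \<circ> b) ` (states m \<alpha> \<times> states m \<beta>)"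
    using assms by (force simp: states_def state_comp tree_aut_mem)
  then show ?thesis
    using assms unfolding finite_state_def by (meson finite_SigmaI finite_imageI finite_subset)
qed

lemma finite_state_inv:
  assumes "tree_aut m \<alpha>" "finite_state m \<alpha>"
  shows "finite_state m (inv_into UNIV \<alpha>)"
proof -
  have "states m (inv_into UNIV \<alpha>) \<subseteq> inv_into UNIV ` states m \<alpha>"
    using assms tree_aut_inv[OF assms(1)] by (auto simp: states_def state_inv tree_aut_mem)
  then show ?thesis
    using assms unfolding finite_state_def by (meson finite_imageI finite_subset)
qed

lemma inv_comp_tree_aut: "tree_aut m \<alpha> \<Longrightarrow> inv_into UNIV \<alpha> \<circ> \<alpha> = id"
  by (simp add: tree_aut_iff bij_is_inj)

lemma group_FA: "group (FA m)"
proof (rule groupI)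
  fix \<alpha> assume "\<alpha> \<in> carrier (FA m)"
  then show "\<exists>\<beta> \<in> carrier (FA m). \<beta> \<otimes>\<^bsub>FA m\<^esub> \<alpha> = \<one>\<^bsub>FA m\<^esub>"
    using inv_comp_tree_aut[of m \<alpha>]
    by (intro bexI[of _ "inv_into UNIV \<alpha>"])
      (simp_all add: FA_simps tree_aut_inv finite_state_inv)
next
  have "states m id = {id}"
    using Nil_in_words by (auto simp: states_def state_id)
  then show "\<one>\<^bsub>FA m\<^esub> \<in> carrier (FA m)"
    by (simp add: FA_simps tree_aut_id finite_state_def)
qed (auto simp: FA_simps tree_aut_comp finite_state_comp comp_assoc)

lemma inv_FA: "\<alpha> \<in> carrier (FA m) \<Longrightarrow> inv\<^bsub>FA m\<^esub> \<alpha> = inv_into UNIV \<alpha>"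
  by (rule group.inv_equality[OF group_FA])
    (auto simp: FA_simps inv_comp_tree_aut tree_aut_inv finite_state_inv)

lemma states_states:
  assumes "tree_aut m \<alpha>" "\<beta> \<in> states m \<alpha>"
  shows "states m \<beta> \<subseteq> states m \<alpha>"
  using assms by (auto simp: states_def state_append words_append)

lemma states_subset_FA:
  assumes "\<alpha> \<in> carrier (FA m)"
  shows "states m \<alpha> \<subseteq> carrier (FA m)"
proof
  fix \<beta> assume \<beta>: "\<beta> \<in> states m \<alpha>"
  then have "states m \<beta> \<subseteq> states m \<alpha>"
    using assms by (simp add: FA_simps states_states)
  then show "\<beta> \<in> carrier (FA m)"
    using assms \<beta>
    by (auto simp: FA_simps finite_state_def states_def tree_aut_state intro: finite_subset)
qed

text \<open>States of products are products of states, and states of inverses are inverses of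
  states. So closure under states passes from the generators to the group, by induction on its
  generation.\<close>

lemma automata_group_generate:
  assumes "finite S" and S: "S \<subseteq> carrier (FA m)" and closed: "\<And>\<alpha>. \<alpha> \<in> S \<Longrightarrow> states m \<alpha> \<subseteq> S"
  shows "automata_group m (generate (FA m) S)"
proof -
  interpret group "FA m" by (rule group_FA)
  let ?G = "generate (FA m) S"
  have G: "?G \<subseteq> carrier (FA m)" using S by (rule generate_incl)
  have "\<forall>v \<in> words m. state m \<alpha> v \<in> ?G" if "\<alpha> \<in> ?G" for \<alpha>
    using that
  proof (induction rule: generate.induct)
    case one
    show ?case using generate.one[of "FA m" S] state_id unfolding FA_simps by metis
  next
    case (incl \<alpha>)
    then show ?case using closed by (auto simp: states_def intro: generate.incl)
  next
    case (inv \<alpha>)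
    then have \<alpha>: "tree_aut m \<alpha>" "inv\<^bsub>FA m\<^esub> \<alpha> = inv_into UNIV \<alpha>" using S by (auto simp: FA_simps inv_FA)
    show ?case
    proof
      fix v assume v: "v \<in> words m"
      let ?u = "inv_into UNIV \<alpha> v"
      have "?u \<in> words m" using v tree_aut_inv[OF \<alpha>(1)] by (simp add: tree_aut_mem)
      then have "state m \<alpha> ?u \<in> S" using closed inv by (auto simp: states_def)
      then show "state m (inv\<^bsub>FA m\<^esub> \<alpha>) v \<in> ?G"
        using \<alpha> v S generate.inv[of "state m \<alpha> ?u" S "FA m"] by (auto simp: state_inv inv_FA subset_iff)
    qed
  next
    case (eng \<alpha> \<beta>)
    then have "tree_aut m \<alpha>" "tree_aut m \<beta>" using G by (auto simp: FA_simps)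
    then have "state m (\<alpha> \<otimes>\<^bsub>FA m\<^esub> \<beta>) v = state m \<alpha> (\<beta> v) \<otimes>\<^bsub>FA m\<^esub> state m \<beta> v"
      and "\<beta> v \<in> words m" if "v \<in> words m" for v
      using that by (simp_all only: FA_simps state_comp tree_aut_mem)
    with eng.IH show ?case by (metis generate.eng)
  qed
  then have "self_similar m ?G"
    by (auto simp: self_similar_def states_def)
  then show ?thesis
    using assms(1) S generate_is_subgroup[OF S] unfolding automata_group_def by blast
qed

section \<open>Isometries of binary sequences and Mealy machines\<close>

text \<open>Isometries for the 2-adic metric, which are the actions of tree automorphisms on the
  boundary of the binary tree. On infinite sequences the actions have formulas that do not mention
  word lengths.\<close>

definition isometry :: "(bits \<Rightarrow> bits) \<Rightarrow> bool" where
  "isometry \<phi> \<longleftrightarrow> bij \<phi> \<and> (\<forall>x y n. (\<forall>i<n. \<phi> x i = \<phi> y i) \<longleftrightarrow> (\<forall>i<n. x i = y i))"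

text \<open>The letters 1 and 2 stand for the digits 0 and 1, and a word is continued by zeros. An
  isometry determines the first \<open>length w\<close> digits of the image from those of the
  argument, so \<open>tree\<close> below does not see this continuation.\<close>

definition pad :: "nat list \<Rightarrow> bits" where
  "pad w i \<longleftrightarrow> i < length w \<and> w ! i = 2"

definition tree :: "(bits \<Rightarrow> bits) \<Rightarrow> nat list \<Rightarrow> nat list" where
  "tree \<phi> w = (if w \<in> words 2 then map (\<lambda>i. if \<phi> (pad w) i then 2 else 1) [0..<length w] else w)"

lemma words_2_nth:
  assumes "w \<in> words 2" "i < length w"
  shows "w ! i = (if pad w i then 2 else 1)"
proof -
  have "w ! i \<in> {1..2}" using assms nth_mem[of i w] unfolding words_def by blast
  then show ?thesis using assms(2) by (auto simp: pad_def)
qed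

lemma length_tree [simp]: "length (tree \<phi> w) = length w"
  by (simp add: tree_def)

lemma tree_mem: "tree \<phi> w \<in> words 2 \<longleftrightarrow> w \<in> words 2"
  by (auto simp: tree_def words_def)

lemma pad_tree: "w \<in> words 2 \<Longrightarrow> i < length w \<Longrightarrow> pad (tree \<phi> w) i = \<phi> (pad w) i"
  by (auto simp: pad_def tree_def)

lemma words_2_eqI:
  "u \<in> words 2 \<Longrightarrow> v \<in> words 2 \<Longrightarrow> length u = length v \<Longrightarrow> (\<And>i. i < length u \<Longrightarrow> pad u i = pad v i) \<Longrightarrow> u = v"
  by (rule nth_equalityI) (auto simp: words_2_nth)

lemma isometry_agree:
  "isometry \<phi> \<Longrightarrow> (\<forall>i<n. \<phi> x i = \<phi> y i) \<longleftrightarrow> (\<forall>i<n. x i = y i)"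
  by (simp add: isometry_def)

lemma isometryD:
  "isometry \<phi> \<Longrightarrow> (\<And>i. i < n \<Longrightarrow> x i = y i) \<Longrightarrow> i < n \<Longrightarrow> \<phi> x i = \<phi> y i"
  using isometry_agree[of \<phi> n x y] by simp

lemma isometry_id: "isometry id"
  unfolding isometry_def using bij_id by simp

lemma isometry_comp: "isometry \<phi> \<Longrightarrow> isometry \<psi> \<Longrightarrow> isometry (\<phi> \<circ> \<psi>)"
  by (simp add: isometry_def bij_comp)

lemma tree_comp:
  assumes "isometry \<phi>" "isometry \<psi>"
  shows "tree (\<phi> \<circ> \<psi>) = tree \<phi> \<circ> tree \<psi>"
proof
  fix w show "tree (\<phi> \<circ> \<psi>) w = (tree \<phi> \<circ> tree \<psi>) w"
  proof (cases "w \<in> words 2")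
    case True
    then have "\<phi> (pad (tree \<psi> w)) i = \<phi> (\<psi> (pad w)) i" if "i < length w" for i
      using that True by (intro isometryD[OF assms(1), where n = "length w"]) (simp_all add: pad_tree)
    then show ?thesis
      using True by (intro words_2_eqI) (simp_all add: pad_tree tree_mem)
  qed (simp add: tree_def)
qed

lemma tree_id: "tree id = id"
proof
  fix w show "tree id w = id w"
    by (cases "w \<in> words 2") (auto simp: words_2_nth tree_def intro!: nth_equalityI)
qed

lemma isometry_inv:
  assumes "isometry \<phi>" "\<phi> \<circ> \<psi> = id"
  shows "isometry \<psi>"
proof -
  have bij: "bij \<phi>" using assms(1) by (simp add: isometry_def)
  have 1: "\<phi> (\<psi> x) = x" for x using assms(2) by (simp add: fun_eq_iff)
  have "\<psi> (\<phi> x) = x" for x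
    by (rule injD[OF bij_is_inj[OF bij]]) (rule 1)
  then have "\<psi> \<circ> \<phi> = id" by auto
  then have "bij \<psi>" by (rule o_bij[OF assms(2)])
  moreover have "(\<forall>i<n. \<phi> (\<psi> x) i = \<phi> (\<psi> y) i) \<longleftrightarrow> (\<forall>i<n. \<psi> x i = \<psi> y i)" for x y n
    by (rule isometry_agree[OF assms(1)])
  then have "(\<forall>i<n. \<psi> x i = \<psi> y i) \<longleftrightarrow> (\<forall>i<n. x i = y i)" for x y n
    by (simp add: 1)
  ultimately show ?thesis by (simp add: isometry_def)
qed

lemma tree_aut_tree:
  assumes "isometry \<phi>"
  shows "tree_aut 2 (tree \<phi>)"
  unfolding tree_aut_iff
proof (intro conjI allI impI)
  have "bij \<phi>" using assms by (simp add: isometry_def)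
  then have "\<phi> \<circ> inv_into UNIV \<phi> = id" "inv_into UNIV \<phi> \<circ> \<phi> = id"
    by (simp_all add: bij_is_inj bij_is_surj flip: surj_iff)
  then obtain \<psi> where inv: "\<phi> \<circ> \<psi> = id" "\<psi> \<circ> \<phi> = id" by blast
  then have "isometry \<psi>" using assms isometry_inv by blast
  then have "tree \<phi> \<circ> tree \<psi> = id" "tree \<psi> \<circ> tree \<phi> = id"
    using assms inv by (simp_all add: tree_id flip: tree_comp)
  then show "bij (tree \<phi>)" by (metis o_bij)
  show "length (tree \<phi> w) = length w" "w \<notin> words 2 \<Longrightarrow> tree \<phi> w = w" for w
    by (simp_all add: tree_def)
  show "\<exists>z. tree \<phi> (u @ v) = tree \<phi> u @ z" if "u @ v \<in> words 2" for u v
  proof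
    have "take (length u) (tree \<phi> (u @ v)) = tree \<phi> u"
    proof (rule nth_equalityI)
      fix i assume "i < length (take (length u) (tree \<phi> (u @ v)))"
      then have i: "i < length u" by simp
      have "\<phi> (pad (u @ v)) i = \<phi> (pad u) i"
        by (rule isometryD[OF assms _ i]) (auto simp: pad_def nth_append)
      then show "take (length u) (tree \<phi> (u @ v)) ! i = tree \<phi> u ! i"
        using that i by (simp add: tree_def words_append)
    qed simp
    then show "tree \<phi> (u @ v) = tree \<phi> u @ drop (length u) (tree \<phi> (u @ v))"
      by (metis append_take_drop_id)
  qed
qed

text \<open>Digit \<open>i\<close> of \<open>\<phi> x\<close> depends only on the first
  \<open>Suc i\<close> digits of \<open>x\<close>, so it can be read off from
  \<open>tree \<phi>\<close> at the word formed by these digits.\<close>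

lemma inj_on_tree: "inj_on tree {\<phi>. isometry \<phi>}"
proof (rule inj_onI, rule ext, rule ext)
  fix \<phi> \<psi> x i assume *: "\<phi> \<in> {\<phi>. isometry \<phi>}" "\<psi> \<in> {\<phi>. isometry \<phi>}" "tree \<phi> = tree \<psi>"
  define w :: "nat list" where "w = map (\<lambda>i. if x i then 2 else 1) [0..<Suc i]"
  have w: "w \<in> words 2" "length w = Suc i" by (auto simp: w_def words_def)
  have "pad w j = x j" if "j < Suc i" for j
    using that by (simp add: pad_def w_def del: upt_Suc)
  then have "\<phi> (pad w) i = \<phi> x i" "\<psi> (pad w) i = \<psi> x i"
    using * isometryD[of _ "Suc i" "pad w" x i] by auto
  then show "\<phi> x i = \<psi> x i"
    using pad_tree[of w i \<phi>] pad_tree[of w i \<psi>] w * by simp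
qed

section \<open>Mealy machines as isometries\<close>

text \<open>Every permutation of two letters is a flip or trivial, so a Mealy machine over the binary
  alphabet that permutes letters in each state is determined by the set \<open>flip\<close> of active states.\<close>

fun run_state :: "('q \<Rightarrow> bool \<Rightarrow> 'q) \<Rightarrow> 'q \<Rightarrow> bits \<Rightarrow> nat \<Rightarrow> 'q" where
  "run_state \<delta> q x 0 = q"
| "run_state \<delta> q x (Suc n) = \<delta> (run_state \<delta> q x n) (x n)"

definition run :: "('q \<Rightarrow> bool \<Rightarrow> 'q) \<Rightarrow> ('q \<Rightarrow> bool) \<Rightarrow> 'q \<Rightarrow> bits \<Rightarrow> bits" where
  "run \<delta> flip q x n \<longleftrightarrow> x n \<noteq> flip (run_state \<delta> q x n)"

lemma run_state_cong: "(\<And>i. i < n \<Longrightarrow> x i = y i) \<Longrightarrow> run_state \<delta> q x n = run_state \<delta> q y n"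
  by (induction n) auto

lemma run_agree: "(\<forall>i<n. run \<delta> flip q x i = run \<delta> flip q y i) \<longleftrightarrow> (\<forall>i<n. x i = y i)"
proof (induction n)
  case (Suc n)
  have "run \<delta> flip q x n = run \<delta> flip q y n \<longleftrightarrow> x n = y n" if "\<forall>i<n. x i = y i"
    using run_state_cong[of n x y \<delta> q] that by (auto simp: run_def)
  then show ?case using Suc by (auto simp: less_Suc_eq)
qed simp

lemma run_state_add:
  "run_state \<delta> q x (n + k) = run_state \<delta> (run_state \<delta> q x n) (\<lambda>i. x (n + i)) k"
  by (induction k) auto

lemma run_add: "run \<delta> flip q x (n + k) = run \<delta> flip (run_state \<delta> q x n) (\<lambda>i. x (n + i)) k"
  by (simp add: run_def run_state_add)

lemma isometry_run: "isometry (run \<delta> flip q)"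
proof -
  \<comment> \<open>The inverse machine reads an output letter, recovers the input letter by undoing
    the flip, and then moves as the original machine does on that input letter.\<close>
  let ?\<delta> = "\<lambda>q b. \<delta> q (b \<noteq> flip q)"
  have "run_state \<delta> q (run ?\<delta> flip q y) n = run_state ?\<delta> q y n" for y n
    by (induction n) (auto simp: run_def)
  then have "run \<delta> flip q (run ?\<delta> flip q y) = y" for y
    by (intro ext) (auto simp: run_def)
  then have "surj (run \<delta> flip q)" by (rule surjI[where f = "run ?\<delta> flip q"])
  moreover have "inj (run \<delta> flip q)"
  proof (intro injI ext)
    fix x y n assume "run \<delta> flip q x = run \<delta> flip q y"
    then show "x n = y n" using run_agree[of "Suc n" \<delta> flip q x y] by simp
  qed
  ultimately have "bij (run \<delta> flip q)" by (simp add: bij_def)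
  then show ?thesis by (simp add: isometry_def run_agree)
qed

text \<open>After reading \<open>v\<close> the machine continues from the state it has reached.
  Hence sections of the tree automorphism correspond to reachable machine states, and finitely many
  of these make it finite-state.\<close>

lemma state_tree_run:
  assumes v: "v \<in> words 2"
  shows "state 2 (tree (run \<delta> flip q)) v = tree (run \<delta> flip (run_state \<delta> q (pad v) (length v)))"
    (is "_ = tree (run \<delta> flip ?q)")
proof (rule state_eqI[OF tree_aut_tree[OF isometry_run] v])
  fix w assume w: "w \<in> words 2"
  let ?\<phi> = "run \<delta> flip q"
  show "tree ?\<phi> (v @ w) = tree ?\<phi> v @ tree (run \<delta> flip ?q) w"
  proof (rule nth_equalityI)
    fix i assume "i < length (tree ?\<phi> (v @ w))"
    then have i: "i < length v + length w" by simp
    show "tree ?\<phi> (v @ w) ! i = (tree ?\<phi> v @ tree (run \<delta> flip ?q) w) ! i"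
    proof (cases "i < length v")
      case True
      then have "?\<phi> (pad (v @ w)) i = ?\<phi> (pad v) i"
        by (intro isometryD[OF isometry_run, where n = "length v"]) (auto simp: pad_def nth_append)
      then show ?thesis using True v w by (simp add: tree_def words_append nth_append)
    next
      case False
      then obtain k where k: "i = length v + k" "k < length w"
        using i by (metis add_less_cancel_left le_add_diff_inverse not_less)
      have "run_state \<delta> q (pad (v @ w)) (length v) = ?q"
        by (rule run_state_cong) (auto simp: pad_def nth_append)
      moreover have "(\<lambda>j. pad (v @ w) (length v + j)) = pad w"
        by (auto simp: pad_def)
      ultimately have "?\<phi> (pad (v @ w)) i = run \<delta> flip ?q (pad w) k"
        by (simp add: k run_add)
      then show ?thesis using k v w by (simp add: tree_def words_append nth_append)
    qed
  qed simp
qed (simp add: tree_def)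

lemma tree_run_in_FA:
  assumes "finite Q" "\<And>x n. run_state \<delta> q x n \<in> Q"
  shows "tree (run \<delta> flip q) \<in> carrier (FA 2)"
proof -
  have "states 2 (tree (run \<delta> flip q)) \<subseteq> (\<lambda>q. tree (run \<delta> flip q)) ` Q"
    using assms(2) by (auto simp: states_def state_tree_run)
  then show ?thesis
    using assms(1) by (auto simp: FA_simps finite_state_def tree_aut_tree isometry_run
        intro: finite_subset)
qed

section \<open>Skew products with 2-adic translations\<close>

definition val :: "bits \<Rightarrow> nat \<Rightarrow> int" where
  "val x n = (\<Sum>i<n. of_bool (x i) * 2 ^ i)"

text \<open>Such a sequence represents a 2-adic integer through the residues of \<open>m n\<close>
  modulo \<open>2 ^ n\<close>. The integers \<open>m n\<close> need not be reduced, so integer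
  combinations can be taken termwise.\<close>

definition coherent :: "(nat \<Rightarrow> int) \<Rightarrow> bool" where
  "coherent m \<longleftrightarrow> (\<forall>n. take_bit n (m (Suc n)) = take_bit n (m n))"

definition translate :: "(nat \<Rightarrow> int) \<Rightarrow> bits \<Rightarrow> bits" where
  "translate m x = (\<lambda>i. bit (val x (Suc i) + m (Suc i)) i)"

lemma val_Suc: "val x (Suc n) = val x n + (if x n then 2 ^ n else 0)"
  by (simp add: val_def)

lemma bit_val: "bit (val x n) i \<longleftrightarrow> i < n \<and> x i"
proof -
  have "val x n = horner_sum of_bool 2 (map x [0..<n])"
    by (auto simp: val_def horner_sum_eq_sum lessThan_atLeast0 intro!: sum.cong)
  then show ?thesis by (auto simp: bit_simps)
qed

lemma take_bit_val: "take_bit k (val x n) = val x (min k n)"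
  by (rule bit_eqI) (auto simp: bit_simps bit_val)

lemma val_less: "val x n < 2 ^ n"
  using take_bit_int_less_exp[of n "val x n"] by (simp add: take_bit_val)

lemma val_nonneg: "0 \<le> val x n"
  by (simp add: val_def sum_nonneg)

lemma val_inject: "(\<And>n. val x n = val y n) \<Longrightarrow> x = y"
  by (rule ext) (metis bit_val lessI)

lemma take_bit_cong_add:
  fixes a b c d :: int
  assumes "take_bit n a = take_bit n b" "take_bit n c = take_bit n d"
  shows "take_bit n (a + c) = take_bit n (b + d)"
  using mod_add_cong[OF assms[unfolded take_bit_eq_mod]] by (simp add: take_bit_eq_mod)

lemma take_bit_cong_mult:
  fixes a b c :: int
  assumes "take_bit n a = take_bit n b"
  shows "take_bit n (c * a) = take_bit n (c * b)"
  using mod_mult_cong[OF refl assms[unfolded take_bit_eq_mod]] by (simp add: take_bit_eq_mod)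

lemma coherent_val: "coherent (val x)"
  by (simp add: coherent_def take_bit_val)

lemma coherent_add: "coherent a \<Longrightarrow> coherent b \<Longrightarrow> coherent (\<lambda>n. a n + b n)"
  unfolding coherent_def by (blast intro: take_bit_cong_add)

lemma coherent_sum:
  assumes "\<And>y. y \<in> S \<Longrightarrow> coherent (m y)"
  shows "coherent (\<lambda>n. \<Sum>y\<in>S. c y * m y n)"
  using assms
  by (induction S rule: infinite_finite_induct)
    (auto simp: coherent_def intro!: take_bit_cong_add take_bit_cong_mult)

lemma coherentD:
  assumes "coherent m" "k \<le> n"
  shows "take_bit k (m n) = take_bit k (m k)"
  using assms(2)
proof (induction n rule: dec_induct)
  case (step n)
  have "take_bit k (m (Suc n)) = take_bit k (take_bit n (m (Suc n)))"
    using step by (simp add: min_absorb1)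
  also have "\<dots> = take_bit k (m n)"
    using assms(1) step by (simp add: coherent_def min_absorb1)
  finally show ?case using step by simp
qed simp

text \<open>Digit \<open>i\<close> of \<open>translate\<close> is computed modulo
  \<open>2 ^ Suc i\<close>; by coherence it can equally be computed at any level
  \<open>n > i\<close>, which yields all digits below \<open>n\<close> at once.\<close>

lemma val_translate:
  assumes "coherent m"
  shows "val (translate m x) n = take_bit n (val x n + m n)"
proof (rule bit_eqI)
  fix i
  have "bit (val x n + m n) i = bit (val x (Suc i) + m (Suc i)) i" if "i < n"
  proof -
    have "take_bit (Suc i) (val x n + m n) = take_bit (Suc i) (val x (Suc i) + m (Suc i))"
      using that coherentD[OF assms, of "Suc i" n] coherentD[OF coherent_val[of x], of "Suc i" n]
      by (intro take_bit_cong_add) auto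
    then show ?thesis by (metis bit_take_bit_iff lessI)
  qed
  then show "bit (val (translate m x) n) i = bit (take_bit n (val x n + m n)) i"
    by (auto simp: bit_val bit_take_bit_iff translate_def)
qed

lemma translate_translate:
  assumes "coherent a" "coherent b"
  shows "translate a (translate b x) = translate (\<lambda>n. a n + b n) x"
proof (rule val_inject)
  fix n
  have "take_bit n (take_bit n (val x n + b n) + a n) = take_bit n (val x n + (a n + b n))"
    by (simp add: take_bit_eq_mod mod_simps algebra_simps)
  then show "val (translate a (translate b x)) n = val (translate (\<lambda>n. a n + b n) x) n"
    using assms by (simp add: val_translate coherent_add)
qed

lemma translate_zero: "translate (\<lambda>n. 0) x = x"
  by (rule ext) (simp add: translate_def bit_val)

text \<open>A translation with one fixed point is by zero. This is the criterion used below to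
  refute that a nontrivial combination of lamps acts trivially.\<close>

lemma translate_fixedD:
  assumes "coherent m" "translate m x = x"
  shows "2 ^ n dvd m n"
proof -
  have "take_bit n (val x n + m n) = take_bit n (val x n)"
    using val_translate[OF assms(1), of x n] by (simp add: assms(2) take_bit_val)
  then have "(val x n + m n) mod 2 ^ n = val x n mod 2 ^ n"
    by (simp add: take_bit_eq_mod)
  then show ?thesis
    by (metis add_diff_cancel_left' mod_eq_dvd_iff)
qed

text \<open>Written addition in base 2: the condition \<open>2 ^ n \<le> val x n + val z n\<close>
  says that there is a carry into place \<open>n\<close>. Together with \<open>carry_Suc\<close> it
  shows that one bit of memory suffices to add.\<close>

lemma translate_val_carry:
  "translate (val z) x n \<longleftrightarrow> (x n \<noteq> (z n \<noteq> (2 ^ n \<le> val x n + val z n)))"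
proof -
  have b: "0 \<le> val x n" "0 \<le> val z n" "val x n < 2 ^ n" "val z n < 2 ^ n"
    by (auto simp: val_nonneg val_less)
  define q where "q = (if 2 ^ n \<le> val x n + val z n then 1 else 0 :: int)"
  have q: "(val x n + val z n) div 2 ^ n = q"
  proof (cases "2 ^ n \<le> val x n + val z n")
    case True
    then show ?thesis using b unfolding q_def
      by (subst div_pos_geq) (auto simp: div_pos_pos_trivial)
  qed (use b in \<open>auto simp: q_def\<close>)
  define d where "d = (of_bool (x n) + of_bool (z n) :: int)"
  have "(val x (Suc n) + val z (Suc n)) = val x n + val z n + d * 2 ^ n"
    by (auto simp: val_Suc d_def)
  then have "(val x (Suc n) + val z (Suc n)) div 2 ^ n = d + q"
    by (simp add: q)
  then show ?thesis
    by (auto simp: translate_def bit_iff_odd d_def q_def)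
qed

lemma carry_Suc:
  "2 ^ Suc n \<le> val x (Suc n) + val z (Suc n) \<longleftrightarrow>
     (x n \<and> z n) \<or> ((x n \<or> z n) \<and> 2 ^ n \<le> val x n + val z n)"
  using val_nonneg[of x n] val_nonneg[of z n] val_less[of x n] val_less[of z n]
  by (cases "x n"; cases "z n") (simp_all add: val_Suc)

section \<open>Skew product actions of a wreath product\<close>

definition acts :: "('b, 'd) monoid_scheme \<Rightarrow> ('b \<Rightarrow> 'x \<Rightarrow> 'x) \<Rightarrow> bool" where
  "acts H \<rho> \<longleftrightarrow> \<rho> \<one>\<^bsub>H\<^esub> = id
     \<and> (\<forall>h \<in> carrier H. \<forall>k \<in> carrier H. \<rho> (h \<otimes>\<^bsub>H\<^esub> k) = \<rho> h \<circ> \<rho> k)"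

text \<open>The lamp at \<open>y\<close> is the conjugate by \<open>y\<close> of the lamp at the
  identity, so it adds the masked value of \<open>c\<close> at the point moved back by
  \<open>y\<close>.\<close>

definition skew_sum :: "('b, 'd) monoid_scheme \<Rightarrow> ('b \<Rightarrow> 'x \<Rightarrow> 'x) \<Rightarrow> ('x \<Rightarrow> bits)
    \<Rightarrow> ('b \<Rightarrow> int) \<Rightarrow> bits \<Rightarrow> 'x \<Rightarrow> nat \<Rightarrow> int" where
  "skew_sum H \<rho> c f p x n =
     (\<Sum>y | y \<in> carrier H \<and> f y \<noteq> 0. f y * val (\<lambda>i. p i \<and> c (\<rho> (inv\<^bsub>H\<^esub> y) x) i) n)"

text \<open>As \<open>(f, h)\<close> is \<open>(f, 1)\<close> times \<open>(1, h)\<close>, the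
  cursor moves the base point first and the lamps are evaluated at
  \<open>\<rho> h x\<close>.\<close>

fun skew :: "('b, 'd) monoid_scheme \<Rightarrow> ('b \<Rightarrow> 'x \<Rightarrow> 'x) \<Rightarrow> ('x \<Rightarrow> bits)
    \<Rightarrow> ('b \<Rightarrow> int) \<times> 'b \<Rightarrow> bits \<times> 'x \<times> bits \<Rightarrow> bits \<times> 'x \<times> bits" where
  "skew H \<rho> c (f, h) (p, x, t) = (p, \<rho> h x, translate (skew_sum H \<rho> c f p (\<rho> h x)) t)"

lemma coherent_skew_sum: "coherent (skew_sum H \<rho> c f p x)"
  unfolding skew_sum_def by (intro coherent_sum coherent_val)

text \<open>The lamp of \<open>g\<close> at \<open>y\<close> becomes a lamp at
  \<open>h \<otimes> y\<close>. Its contribution at \<open>\<rho> h x\<close> equals the old one at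
  \<open>x\<close>, because the inverse of \<open>h \<otimes> y\<close> times \<open>h\<close> is
  the inverse of \<open>y\<close>.\<close>

lemma (in group) skew_sum_mult:
  assumes act: "acts G \<rho>" and a: "(f, h) \<in> carrier (wreath integer_group G)"
    and b: "(g, k) \<in> carrier (wreath integer_group G)"
  shows "skew_sum G \<rho> c (fst ((f, h) \<otimes>\<^bsub>wreath integer_group G\<^esub> (g, k))) p (\<rho> h x) n
    = skew_sum G \<rho> c f p (\<rho> h x) n + skew_sum G \<rho> c g p x n"
proof -
  let ?V = "\<lambda>y x. val (\<lambda>i. p i \<and> c (\<rho> (inv y) x) i) n"
  let ?g = "\<lambda>y. g (inv h \<otimes> y)"
  have h: "h \<in> carrier G" and fin: "finite {y. y \<in> carrier G \<and> f y \<noteq> 0}"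
    "finite {y. y \<in> carrier G \<and> g y \<noteq> 0}"
    using a b by (auto simp: wreath_carrier_iff)
  have img: "{y. y \<in> carrier G \<and> ?g y \<noteq> 0} = (\<lambda>y. h \<otimes> y) ` {y. y \<in> carrier G \<and> g y \<noteq> 0}"
    (is "?L = ?R")
  proof (intro equalityI subsetI)
    fix y assume "y \<in> ?L"
    then show "y \<in> ?R"
      using h by (intro image_eqI[of _ _ "inv h \<otimes> y"]) (auto simp: m_assoc[symmetric])
  qed (use h in \<open>auto simp: m_assoc[symmetric]\<close>)
  have shift: "?V (h \<otimes> y) (\<rho> h x) = ?V y x" if "y \<in> carrier G" for y
  proof -
    have "\<rho> (inv (h \<otimes> y)) (\<rho> h x) = \<rho> (inv (h \<otimes> y) \<otimes> h) x"
      using act h that by (simp add: acts_def)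
    also have "inv (h \<otimes> y) \<otimes> h = inv y"
      using h that by (simp add: inv_mult_group m_assoc)
    finally show ?thesis by simp
  qed
  have g: "(\<Sum>y | y \<in> carrier G \<and> ?g y \<noteq> 0. ?g y * ?V y (\<rho> h x)) = skew_sum G \<rho> c g p x n"
    unfolding img skew_sum_def
    using h by (subst sum.reindex) (auto simp: inj_on_def shift m_assoc[symmetric] intro!: sum.cong)
  \<comment> \<open>Values of \<open>f\<close> and of the shifted \<open>g\<close> may cancel, so
    all three sums are extended to the union of the two supports.\<close>
  let ?U = "{y. y \<in> carrier G \<and> f y \<noteq> 0} \<union> {y. y \<in> carrier G \<and> ?g y \<noteq> 0}"
  have U: "finite ?U" using fin by (simp add: img)
  have "skew_sum G \<rho> c (fst ((f, h) \<otimes>\<^bsub>wreath integer_group G\<^esub> (g, k))) p (\<rho> h x) n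
     = (\<Sum>y\<in>?U. (f y + ?g y) * ?V y (\<rho> h x))"
    unfolding skew_sum_def by (intro sum.mono_neutral_cong_left U) (auto simp: wreath_mult)
  also have "\<dots> = (\<Sum>y\<in>?U. f y * ?V y (\<rho> h x)) + (\<Sum>y\<in>?U. ?g y * ?V y (\<rho> h x))"
    by (simp add: distrib_right sum.distrib)
  also have "(\<Sum>y\<in>?U. f y * ?V y (\<rho> h x)) = skew_sum G \<rho> c f p (\<rho> h x) n"
    unfolding skew_sum_def by (intro sum.mono_neutral_right U) auto
  also have "(\<Sum>y\<in>?U. ?g y * ?V y (\<rho> h x)) = skew_sum G \<rho> c g p x n"
    unfolding g[symmetric] by (intro sum.mono_neutral_right U) auto
  finally show ?thesis .
qed

lemma (in group) acts_skew:
  assumes act: "acts G \<rho>"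
  shows "acts (wreath integer_group G) (skew G \<rho> c)"
  unfolding acts_def
proof (intro conjI ballI)
  show "skew G \<rho> c \<one>\<^bsub>wreath integer_group G\<^esub> = id"
    using act by (auto simp: fun_eq_iff wreath_one acts_def skew_sum_def[abs_def] translate_zero)
next
  fix a b assume ab: "a \<in> carrier (wreath integer_group G)" "b \<in> carrier (wreath integer_group G)"
  obtain f h g k where [simp]: "a = (f, h)" "b = (g, k)"
    by (cases a; cases b)
  have hk: "h \<in> carrier G" "k \<in> carrier G"
    using ab by (auto simp: wreath_carrier_iff)
  obtain e where e: "(f, h) \<otimes>\<^bsub>wreath integer_group G\<^esub> (g, k) = (e, h \<otimes> k)"
    by (simp add: wreath_mult)
  have \<rho>: "\<rho> (h \<otimes> k) x = \<rho> h (\<rho> k x)" for x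
    using act hk by (simp add: acts_def)
  have sum: "skew_sum G \<rho> c e p (\<rho> h (\<rho> k x))
      = (\<lambda>n. skew_sum G \<rho> c f p (\<rho> h (\<rho> k x)) n + skew_sum G \<rho> c g p (\<rho> k x) n)" for p x
    using skew_sum_mult[OF act ab[simplified], of c p "\<rho> k x"] by (auto simp: e)
  show "skew G \<rho> c (a \<otimes>\<^bsub>wreath integer_group G\<^esub> b) = skew G \<rho> c a \<circ> skew G \<rho> c b"
    by (auto simp: e \<rho> sum translate_translate coherent_skew_sum intro!: ext)
qed

section \<open>The actions of the iterated wreath products\<close>

definition zpow :: "('x \<Rightarrow> 'x) \<Rightarrow> int \<Rightarrow> 'x \<Rightarrow> 'x" where
  "zpow a k = a [^]\<^bsub>BijGroup UNIV\<^esub> k"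

lemma BijGroup_UNIV:
  "carrier (BijGroup UNIV) = Collect bij"
  "bij f \<Longrightarrow> bij g \<Longrightarrow> f \<otimes>\<^bsub>BijGroup UNIV\<^esub> g = f \<circ> g"
  "\<one>\<^bsub>BijGroup UNIV\<^esub> = id"
  by (auto simp: BijGroup_def Bij_def compose_def comp_def id_def)

lemma
  assumes "bij a"
  shows zpow_0: "zpow a 0 = id"
    and zpow_add: "zpow a (j + k) = zpow a j \<circ> zpow a k"
    and zpow_of_nat: "zpow a (int n) = a ^^ n"
proof -
  interpret group "BijGroup (UNIV :: 'a set)" by (rule group_BijGroup)
  have a: "a \<in> carrier (BijGroup UNIV)" using assms by (simp add: BijGroup_UNIV)
  have pow: "bij (zpow a k)" for k
    using int_pow_closed[OF a, of k] by (simp add: BijGroup_UNIV zpow_def)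
  show 0: "zpow a 0 = id" by (simp add: zpow_def BijGroup_UNIV)
  show add: "zpow a (j + k) = zpow a j \<circ> zpow a k" for j k
    using int_pow_mult[OF a, of j k] BijGroup_UNIV(2)[OF pow pow, of j k] by (simp add: zpow_def)
  have "zpow a 1 = a" using a by (simp add: zpow_def)
  then show "zpow a (int n) = a ^^ n"
    by (induction n) (simp_all add: 0 add)
qed

lemma zpow_1: "bij a \<Longrightarrow> zpow a 1 = a"
  using zpow_of_nat[of a 1] by simp

text \<open>Multiplication by \<open>1 + X\<close> on the power series ring over the field with two elements.\<close>

definition pascal :: "bits \<Rightarrow> bits" where
  "pascal = run (\<lambda>_ b. b) id False"

lemma run_state_last: "run_state (\<lambda>_ b. b) q x n = (if n = 0 then q else x (n - 1))"
  by (cases n) auto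

lemma pascal_0: "pascal x 0 = x 0"
  and pascal_Suc: "pascal x (Suc n) \<longleftrightarrow> x (Suc n) \<noteq> x n"
  by (simp_all add: pascal_def run_def run_state_last)

lemma bij_pascal: "bij pascal"
  using isometry_run[of "\<lambda>_ b. b" id False] by (simp add: pascal_def isometry_def)

text \<open>The sequence is the power series of \<open>1 / (1 - X ^ D)\<close>. Since
  \<open>(1 + X) ^ e\<close> has degree below \<open>D\<close>, the product repeats its coefficients
  in consecutive blocks of length \<open>D\<close> without overlap.\<close>

lemma pascal_power_dvd:
  assumes "e < D" "l < D"
  shows "(pascal ^^ e) (\<lambda>i. D dvd i) (D * m + l) \<longleftrightarrow> odd (e choose l)"
  using assms
proof (induction e arbitrary: m l)
  case 0
  then have "D dvd D * m + l \<longleftrightarrow> D dvd l" by (metis dvd_add_right_iff dvd_triv_left)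
  also have "\<dots> \<longleftrightarrow> l = 0" using 0 by (auto dest: dvd_imp_le)
  finally show ?case by (cases l) auto
next
  case (Suc e)
  let ?x = "(pascal ^^ e) (\<lambda>i. D dvd i)"
  show ?case
  proof (cases l)
    case [simp]: 0
    show ?thesis
    proof (cases m)
      case 0
      then show ?thesis using Suc.IH[of 0 0] Suc.prems by (simp add: pascal_0)
    next
      case (Suc m')
      have "D * m = Suc (D * m' + (D - 1))" using Suc Suc.prems by simp
      \<comment> \<open>The first digit of a block also receives the last digit of the preceding
        block, which is \<open>e choose (D - 1)\<close> modulo 2 and vanishes because
        \<open>Suc e < D\<close>.\<close>
      moreover have "\<not> ?x (D * m' + (D - 1))"
      proof -
        have e: "e < D - 1" "D - 1 < D" "e < D" using Suc.prems by linarith+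
        show ?thesis using Suc.IH[OF e(3,2), of m'] e(1) by (simp add: binomial_eq_0 del: One_nat_def)
      qed
      moreover have "?x (D * m)" using Suc.IH[of 0 m] Suc.prems by simp
      ultimately show ?thesis by (simp add: pascal_Suc)
    qed
  next
    case (Suc l')
    then show ?thesis
      using Suc.IH[of l m] Suc.IH[of l' m] Suc.prems by (auto simp: pascal_Suc)
  qed
qed

definition rho0 :: "int \<Rightarrow> bits \<times> bits \<Rightarrow> bits \<times> bits" where
  "rho0 k = (\<lambda>(r, u). (r, zpow pascal k u))"

definition rho1 :: "(int \<Rightarrow> int) \<times> int \<Rightarrow> bits \<times> (bits \<times> bits) \<times> bits \<Rightarrow> bits \<times> (bits \<times> bits) \<times> bits" where
  "rho1 = skew integer_group rho0 snd"

text \<open>The digits never return from 0 to 1. This makes a late digit vanish for finitely many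
  points simultaneously, and lets an automaton compute the digits with one bit of memory.\<close>

definition agree :: "bits \<times> (bits \<times> bits) \<times> bits \<Rightarrow> bits" where
  "agree = (\<lambda>(s, (r, u), v) i. \<forall>j\<le>i. u j = r j \<and> \<not> v j)"

definition rho2 where
  "rho2 = skew (wreath integer_group integer_group) rho1 agree"

lemma acts_rho0: "acts integer_group rho0"
  by (auto simp: acts_def rho0_def zpow_0 zpow_add bij_pascal intro!: ext)

lemma acts_rho1: "acts (wreath integer_group integer_group) rho1"
  unfolding rho1_def by (rule group.acts_skew[OF group_integer_group acts_rho0])

lemma acts_rho2: "acts W3 rho2"
  unfolding rho2_def W3_def
  by (rule group.acts_skew[OF group_wreath[OF group_integer_group group_integer_group] acts_rho1])

section \<open>Separating finitely many elements of the inner wreath product\<close>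

lemma val_add: "val x (n + k) = val x n + (\<Sum>i<k. of_bool (x (n + i)) * 2 ^ (n + i))"
  by (induction k) (simp_all add: val_def)

text \<open>The mask keeps only place \<open>m\<close> of block \<open>m\<close>. Thus the
  coefficients of \<open>(1 + X) ^ e\<close> modulo 2 become binary digits at places
  \<open>D + 1\<close> apart, leaving room for integer multiples of them.\<close>

lemma val_diagonal_mask:
  assumes "e < D" "M \<le> D"
  shows "val (\<lambda>i. i div D = i mod D \<and> (pascal ^^ e) (\<lambda>i. D dvd i) i) (D * M)
    = (\<Sum>m<M. of_bool (odd (e choose m)) * 2 ^ (D * m + m))"
  using assms(2)
proof (induction M)
  case 0
  then show ?case by (simp add: val_def)
next
  case (Suc M)
  define z where "z = (\<lambda>i. i div D = i mod D \<and> (pascal ^^ e) (\<lambda>i. D dvd i) i)"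
  have z: "z (D * M + i) \<longleftrightarrow> i = M \<and> odd (e choose M)" if "i < D" for i
  proof -
    have "z (D * M + i) \<longleftrightarrow> M = i \<and> (pascal ^^ e) (\<lambda>i. D dvd i) (D * M + i)"
      using that by (simp add: z_def)
    then show ?thesis unfolding pascal_power_dvd[OF assms(1) that] by auto
  qed
  have "(\<Sum>i<D. of_bool (z (D * M + i)) * 2 ^ (D * M + i))
      = (\<Sum>i<D. if i = M then of_bool (odd (e choose M)) * 2 ^ (D * M + M) else (0::int))"
    by (intro sum.cong) (auto simp: z)
  also have "\<dots> = of_bool (odd (e choose M)) * 2 ^ (D * M + M)"
    using Suc.prems by simp
  finally show ?case
    using Suc val_add[of z "D * M" D] by (simp add: z_def[symmetric] algebra_simps)
qed

text \<open>Unitriangularity: let \<open>y0\<close> be the least point of the support and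
  \<open>m = E - y0\<close>. Every other exponent \<open>E - y\<close> is smaller than
  \<open>m\<close>, so only the term \<open>m choose m = 1\<close> of \<open>y0\<close>
  survives.\<close>

lemma choose_mod_2_independent:
  fixes f :: "int \<Rightarrow> int"
  assumes "finite {y. f y \<noteq> 0}" "f \<noteq> (\<lambda>y. 0)" "\<And>y. f y \<noteq> 0 \<Longrightarrow> \<bar>y\<bar> \<le> E"
  shows "\<exists>m. int m \<le> 2 * E \<and> (\<Sum>y | f y \<noteq> 0. f y * of_bool (odd (nat (E - y) choose m))) \<noteq> 0"
proof -
  let ?Y = "{y. f y \<noteq> 0}"
  have ne: "?Y \<noteq> {}" using assms(2) by auto
  define y0 where "y0 = Min ?Y"
  have y0: "f y0 \<noteq> 0" "\<And>y. f y \<noteq> 0 \<Longrightarrow> y0 \<le> y"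
    using Min_in[OF assms(1) ne] Min_le[OF assms(1)] by (auto simp: y0_def)
  define m where "m = nat (E - y0)"
  have "f y * of_bool (odd (nat (E - y) choose m)) = (if y = y0 then f y0 else 0)"
    if "y \<in> ?Y" for y
  proof (cases "y = y0")
    case False
    then have "nat (E - y) < m"
      using that y0(2)[of y] assms(3)[of y] by (auto simp: m_def)
    then show ?thesis using False by (simp add: binomial_eq_0)
  qed (simp add: m_def)
  then have "(\<Sum>y\<in>?Y. f y * of_bool (odd (nat (E - y) choose m))) = f y0"
    using assms(1) y0(1) by simp
  moreover have "int m \<le> 2 * E" using assms(3)[OF y0(1)] by (auto simp: m_def)
  ultimately show ?thesis using y0(1) by auto
qed

lemma finite_common_bound:
  assumes "finite S" "\<And>x. x \<in> S \<Longrightarrow> \<exists>b::int. P x b" "\<And>x b c. P x b \<Longrightarrow> b \<le> c \<Longrightarrow> P x c"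
  shows "\<exists>b\<ge>0. \<forall>x\<in>S. P x b"
  using assms(1,2)
proof (induction S rule: finite_induct)
  case (insert x S)
  then obtain b c where "b \<ge> 0" "\<forall>x\<in>S. P x b" "P x c" by blast
  then show ?case using assms(3) by (intro exI[of _ "max b c"]) (auto simp: max_def)
qed auto

lemma rho1_separates:
  assumes S: "finite S" "S \<subseteq> carrier (wreath integer_group integer_group)"
    and one: "\<one>\<^bsub>wreath integer_group integer_group\<^esub> \<notin> S"
  shows "\<exists>s r. \<forall>g\<in>S. \<exists>i. \<not> agree (rho1 g (s, (r, r), \<lambda>_. False)) i"
proof -
  let ?P = "\<lambda>g (b::int). \<bar>snd g\<bar> \<le> b \<and> (\<forall>y. fst g y \<noteq> 0 \<longrightarrow> \<bar>y\<bar> \<le> b) \<and> (\<Sum>y | fst g y \<noteq> 0. \<bar>fst g y\<bar>) \<le> b"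
  have fin: "finite {y. fst g y \<noteq> 0}" if "g \<in> S" for g
    using S(2) that by (cases g) (auto simp: wreath_carrier_iff)
  have "\<exists>b. ?P g b" if "g \<in> S" for g
  proof -
    have "\<exists>b. \<forall>y\<in>{y. fst g y \<noteq> 0}. \<bar>y\<bar> \<le> b"
      using finite_common_bound[OF fin[OF that], of "\<lambda>y b. \<bar>y\<bar> \<le> b"] by force
    then obtain b where "\<forall>y. fst g y \<noteq> 0 \<longrightarrow> \<bar>y\<bar> \<le> b" by auto
    then have "?P g (max b (max \<bar>snd g\<bar> (\<Sum>y | fst g y \<noteq> 0. \<bar>fst g y\<bar>)))"
      by (auto simp: le_max_iff_disj)
    then show ?thesis ..
  qed
  moreover have "?P g c" if "?P g b" "b \<le> c" for g b c
    using that by (auto intro: order.trans)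
  ultimately have "\<exists>b\<ge>0. \<forall>g\<in>S. ?P g b"
    by (rule finite_common_bound[OF S(1)])
  then obtain E where E: "0 \<le> E" "\<And>g. g \<in> S \<Longrightarrow> ?P g E" by blast
  \<comment> \<open>\<open>E\<close> bounds cursors, lamp positions and the total size of the lamps.
    Exponents \<open>E - y\<close> and the index \<open>m\<close> below are at most
    \<open>2 * E\<close>, so \<open>D > 3 * E\<close> gives exponents below \<open>D\<close> and
    \<open>D - m > E\<close>.\<close>
  define D where "D = nat (3 * E) + 1"
  have D: "D > 0" "int D > 3 * E" using E(1) by (auto simp: D_def)
  define r0 where "r0 = (\<lambda>i. D dvd i)"
  \<comment> \<open>The initial shift by \<open>E\<close> makes all exponents \<open>E - y\<close>
    nonnegative, so that they are powers described by binomial coefficients.\<close>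
  define r where "r = zpow pascal E r0"
  define s where "s = (\<lambda>i. i div D = i mod D)"
  have shift: "zpow pascal k r = zpow pascal (k + E) r0" for k
    by (simp add: r_def zpow_add[OF bij_pascal])
  have free: "zpow pascal k r \<noteq> r" if k: "k \<noteq> 0" "\<bar>k\<bar> \<le> E" for k
  proof
    assume eq: "zpow pascal k r = r"
    have "zpow pascal j (zpow pascal k r) = zpow pascal j r" for j by (simp add: eq)
    then have 1: "zpow pascal (j + k + E) r0 = zpow pascal (j + E) r0" for j
      by (simp add: shift zpow_add[OF bij_pascal] add.assoc)
    \<comment> \<open>A positive power \<open>n < D\<close> of \<open>pascal\<close> would fix
      \<open>r0\<close>, but its image has digit \<open>n choose n = 1\<close> at place
      \<open>n\<close>, which is not a multiple of \<open>D\<close>.\<close>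
    define n where "n = nat \<bar>k\<bar>"
    have n: "0 < n" "n < D" using k D by (auto simp: n_def)
    have "zpow pascal (int n) r0 = r0"
      using 1[of "- E"] 1[of "- k - E"] by (cases "k \<ge> 0") (auto simp: n_def zpow_0[OF bij_pascal])
    then have "(pascal ^^ n) r0 n = r0 n" by (simp add: zpow_of_nat[OF bij_pascal])
    then show False
      using pascal_power_dvd[of n D n 0] n by (auto simp: r0_def dest: dvd_imp_le)
  qed
  have "\<exists>i. \<not> agree (rho1 g (s, (r, r), \<lambda>_. False)) i" if g: "g \<in> S" for g
  proof -
    obtain f k where [simp]: "g = (f, k)" by (cases g)
    define M where "M = skew_sum integer_group rho0 snd f s (r, zpow pascal k r)"
    have rho: "rho1 g (s, (r, r), \<lambda>_. False) = (s, (r, zpow pascal k r), translate M (\<lambda>_. False))"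
      by (simp add: rho1_def rho0_def M_def)
    show ?thesis
    proof (cases "k = 0")
      case False
      then obtain i where "zpow pascal k r i \<noteq> r i"
        using free[of k] E(2)[OF g] by (auto simp: fun_eq_iff)
      then show ?thesis unfolding rho by (auto simp: agree_def)
    next
      case [simp]: True
      have f: "f \<noteq> (\<lambda>y. 0)" using one g by (auto simp: wreath_one)
      let ?Y = "{y. f y \<noteq> 0}"
      let ?\<phi> = "\<lambda>m. \<Sum>y\<in>?Y. f y * of_bool (odd (nat (E - y) choose m))"
      have Y: "finite ?Y" "\<And>y. y \<in> ?Y \<Longrightarrow> \<bar>y\<bar> \<le> E" "(\<Sum>y\<in>?Y. \<bar>f y\<bar>) \<le> E"
        using fin[OF g] E(2)[OF g] by auto
      \<comment> \<open>With the least such \<open>m\<close> all earlier blocks cancel, so the sum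
        up to the end of block \<open>m\<close> is a single term.\<close>
      define m where "m = (LEAST m. ?\<phi> m \<noteq> 0)"
      obtain m' where m': "int m' \<le> 2 * E" "?\<phi> m' \<noteq> 0"
        using choose_mod_2_independent[OF Y(1) f, of E] Y(2) by auto
      have m: "?\<phi> m \<noteq> 0" "m \<le> m'" "\<And>j. j < m \<Longrightarrow> ?\<phi> j = 0"
        using LeastI[of "\<lambda>m. ?\<phi> m \<noteq> 0", OF m'(2)] Least_le[of "\<lambda>m. ?\<phi> m \<noteq> 0", OF m'(2)]
          not_less_Least[of _ "\<lambda>m. ?\<phi> m \<noteq> 0"] unfolding m_def by blast+
      have mD: "Suc m \<le> D" "nat E < D - m" using m(2) m'(1) D E(1) by linarith+
      have "M (D * Suc m) = (\<Sum>y\<in>?Y. f y * (\<Sum>j<Suc m. of_bool (odd (nat (E - y) choose j)) * 2 ^ (D * j + j)))"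
        unfolding M_def skew_sum_def
      proof (rule sum.cong)
        fix y assume "y \<in> ?Y"
        then have y: "nat (E - y) < D" "- y + E = int (nat (E - y))" using Y(2)[of y] D by auto
        have "zpow pascal (- y) r = (pascal ^^ nat (E - y)) r0"
          unfolding shift y(2) by (simp only: zpow_of_nat[OF bij_pascal])
        then show "f y * val (\<lambda>i. s i \<and> snd (rho0 (inv\<^bsub>integer_group\<^esub> y) (r, zpow pascal k r)) i) (D * Suc m)
            = f y * (\<Sum>j<Suc m. of_bool (odd (nat (E - y) choose j)) * 2 ^ (D * j + j))"
          using val_diagonal_mask[OF y(1) mD(1)]
          by (simp add: rho0_def s_def r0_def zpow_0[OF bij_pascal])
      qed simp
      also have "\<dots> = (\<Sum>j<Suc m. ?\<phi> j * 2 ^ (D * j + j))"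
        by (simp only: sum_distrib_left sum_distrib_right mult.assoc) (rule sum.swap)
      also have "\<dots> = ?\<phi> m * 2 ^ (D * m + m)"
        using m(3) by simp
      finally have M: "M (D * Suc m) = ?\<phi> m * 2 ^ (D * m + m)" .
      have "translate M (\<lambda>_. False) \<noteq> (\<lambda>_. False)"
      proof
        assume "translate M (\<lambda>_. False) = (\<lambda>_. False)"
        then have "2 ^ (D * Suc m) dvd M (D * Suc m)"
          by (intro translate_fixedD) (auto simp: M_def coherent_skew_sum)
        \<comment> \<open>After cancelling \<open>2 ^ (D * m + m)\<close>, the nonzero integer
          \<open>?\<phi> m\<close> would be divisible by \<open>2 ^ (D - m)\<close>, although its
          absolute value is at most \<open>E < D - m\<close>.\<close>
        moreover have "D * Suc m = (D - m) + (D * m + m)" using mD(1) by simp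
        then have "(2::int) ^ (D * Suc m) = 2 ^ (D - m) * 2 ^ (D * m + m)"
          by (metis power_add)
        ultimately have "2 ^ (D - m) * 2 ^ (D * m + m) dvd ?\<phi> m * 2 ^ (D * m + m)"
          by (simp only: M)
        then have "2 ^ (D - m) dvd ?\<phi> m" by simp
        then have "2 ^ (D - m) \<le> \<bar>?\<phi> m\<bar>" using m(1) dvd_imp_le_int[of "?\<phi> m" "2 ^ (D - m)"] by simp
        also have "\<dots> \<le> (\<Sum>y\<in>?Y. \<bar>f y * of_bool (odd (nat (E - y) choose m))\<bar>)" by (rule sum_abs)
        also have "\<dots> \<le> (\<Sum>y\<in>?Y. \<bar>f y\<bar>)" by (intro sum_mono) auto
        also have "\<dots> \<le> E" by (rule Y(3))
        also have "\<dots> < int (D - m)" using mD E(1) by linarith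
        also have "\<dots> < 2 ^ (D - m)" by (metis of_nat_less_two_power)
        finally show False by simp
      qed
      then show ?thesis unfolding rho by (auto simp: agree_def fun_eq_iff)
    qed
  qed
  then show ?thesis by blast
qed

section \<open>Faithfulness of the action of the iterated wreath product\<close>

lemma rho2_faithful:
  assumes a: "a \<in> carrier W3" and id: "rho2 a = id"
  shows "a = \<one>\<^bsub>W3\<^esub>"
proof -
  let ?H = "wreath integer_group integer_group"
  interpret H: group ?H by (intro group_wreath group_integer_group)
  obtain F h where [simp]: "a = (F, h)" by (cases a)
  have h: "h \<in> carrier ?H" and F: "finite {y \<in> carrier ?H. F y \<noteq> 0}" "\<And>y. y \<notin> carrier ?H \<Longrightarrow> F y = 0"
    using a by (auto simp: W3_def wreath_carrier_iff)
  have rho: "rho1 h x = x" "translate (skew_sum ?H rho1 agree F p x) t = t" for p x t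
    using fun_cong[OF id, of "(p, x, t)"] by (auto simp: rho2_def)
  have "h = \<one>\<^bsub>?H\<^esub>"
  proof (rule ccontr)
    assume "h \<noteq> \<one>\<^bsub>?H\<^esub>"
    then obtain s r i where "\<not> agree (rho1 h (s, (r, r), \<lambda>_. False)) i"
      using rho1_separates[of "{h}"] h by auto
    then show False by (simp add: rho agree_def)
  qed
  moreover have "F y0 = 0" for y0
  proof (rule ccontr)
    assume y0: "F y0 \<noteq> 0"
    then have y0H: "y0 \<in> carrier ?H" using F(2) by blast
    let ?Y = "{y \<in> carrier ?H. F y \<noteq> 0}"
    \<comment> \<open>At the base point \<open>rho1 y0 q\<close> the lamp at \<open>y\<close> sees
      \<open>rho1 (?T y) q\<close>. For \<open>y = y0\<close> this is \<open>q\<close> itself, where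
      all digits of \<open>agree\<close> are 1; the other \<open>?T y\<close> are nontrivial, so
      \<open>rho1_separates\<close> applies to them.\<close>
    let ?T = "\<lambda>y. inv\<^bsub>?H\<^esub> y \<otimes>\<^bsub>?H\<^esub> y0"
    have "\<one>\<^bsub>?H\<^esub> \<notin> ?T ` (?Y - {y0})"
    proof
      assume "\<one>\<^bsub>?H\<^esub> \<in> ?T ` (?Y - {y0})"
      then obtain y where "y \<in> ?Y - {y0}" "?T y = \<one>\<^bsub>?H\<^esub>"
        by (elim imageE) (rule that[OF _ sym])
      then have y: "y \<in> carrier ?H" "y \<noteq> y0" "?T y = \<one>\<^bsub>?H\<^esub>" by auto
      then have "y0 = y" using y0H by (metis H.inv_equality H.inv_inv H.inv_closed)
      then show False using y(2) by simp
    qed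
    then have "\<exists>s r. \<forall>g\<in>?T ` (?Y - {y0}). \<exists>i. \<not> agree (rho1 g (s, (r, r), \<lambda>_. False)) i"
      using F(1) y0H by (intro rho1_separates) auto
    then obtain s r where q: "\<And>y. y \<in> ?Y - {y0} \<Longrightarrow> \<exists>i. \<not> agree (rho1 (?T y) (s, (r, r), \<lambda>_. False)) i"
      by blast
    define q where "q = (s, (r, r), (\<lambda>_. False) :: bits)"
    have T: "rho1 (inv\<^bsub>?H\<^esub> y) (rho1 y0 q) = rho1 (?T y) q" if "y \<in> carrier ?H" for y
      using acts_rho1 that y0H by (simp add: acts_def)
    have "\<exists>N\<ge>0. \<forall>y\<in>?Y - {y0}. \<not> agree (rho1 (?T y) q) (nat N)"
    proof (rule finite_common_bound)
      show "\<exists>N. \<not> agree (rho1 (?T y) q) (nat N)" if "y \<in> ?Y - {y0}" for y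
        using q[OF that] unfolding q_def by (metis nat_int)
      show "\<not> agree (rho1 (?T y) q) (nat c)" if "\<not> agree (rho1 (?T y) q) (nat b)" "b \<le> c" for y b c
        using that nat_mono[OF that(2)] unfolding agree_def case_prod_beta by (meson order_trans)
    qed (use F(1) in simp)
    then obtain N where N: "\<And>y. y \<in> ?Y - {y0} \<Longrightarrow> \<not> agree (rho1 (?T y) q) N" by blast
    have N0: "agree (rho1 (?T y0) q) N"
      using acts_rho1 y0H by (simp add: acts_def q_def agree_def)
    define n where "n = nat \<bar>F y0\<bar>"
    \<comment> \<open>The mask admits only digit \<open>N\<close>, where the lamp at
      \<open>y0\<close> contributes and no other lamp does. The sum is \<open>F y0 * 2 ^ N\<close>,
      and a trivial translation would force \<open>2 ^ Suc n\<close> to divide \<open>F y0\<close>,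
      whose absolute value is \<open>n\<close>.\<close>
    let ?p = "\<lambda>i. i = N"
    have V: "val (\<lambda>i. ?p i \<and> c i) (N + Suc n) = of_bool (c N) * 2 ^ N" for c
    proof -
      have "val (\<lambda>i. ?p i \<and> c i) (N + Suc n) = (\<Sum>i<N + Suc n. if i = N then of_bool (c N) * 2 ^ N else 0)"
        unfolding val_def by (intro sum.cong) auto
      then show ?thesis by simp
    qed
    have "2 ^ (N + Suc n) dvd skew_sum ?H rho1 agree F ?p (rho1 y0 q) (N + Suc n)"
      using rho(2)[of ?p "rho1 y0 q"] by (intro translate_fixedD coherent_skew_sum) simp
    also have "skew_sum ?H rho1 agree F ?p (rho1 y0 q) (N + Suc n)
        = (\<Sum>y\<in>?Y. if y = y0 then F y0 * 2 ^ N else 0)"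
      unfolding skew_sum_def V by (intro sum.cong) (auto simp: T N N0)
    also have "\<dots> = F y0 * 2 ^ N" using F(1) y0 y0H by simp
    finally have "2 ^ Suc n dvd F y0"
      by (simp add: power_add mult.commute)
    then have "2 ^ Suc n \<le> \<bar>F y0\<bar>"
      using y0 dvd_imp_le_int[of "F y0" "2 ^ Suc n"] by simp
    also have "\<dots> = int n" by (simp add: n_def)
    also have "\<dots> < 2 ^ n" by (rule of_nat_less_two_power)
    finally show False by simp
  qed
  ultimately show ?thesis by (auto simp: W3_def wreath_one)
qed

section \<open>Finite automata for the generators\<close>

lemma skew_cursor: "skew G \<rho> c (cursor h) (p, x, t) = (p, \<rho> h x, t)"
  by (simp add: cursor_def skew_sum_def[abs_def] translate_zero)

lemma (in group) skew_lamp: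
  assumes "acts G \<rho>"
  shows "skew G \<rho> c (lamp G) (p, x, t) = (p, x, translate (val (\<lambda>i. p i \<and> c x i)) t)"
proof -
  have "{y. y \<in> carrier G \<and> (if y = \<one> then 1 else 0 :: int) \<noteq> 0} = {\<one>}" by auto
  then show ?thesis
    using assms by (simp add: lamp_def skew_sum_def[abs_def] acts_def)
qed

section \<open>Encoding points as binary sequences\<close>

type_synonym point = "bits \<times> (bits \<times> (bits \<times> bits) \<times> bits) \<times> bits"

text \<open>The order matters: within a block, \<open>v\<close> comes after \<open>s\<close> and
  \<open>u\<close>, and \<open>t\<close> after all other coordinates, so each letter that is changed
  comes after the letters of its block on which the change depends.\<close>

fun interleave :: "point \<Rightarrow> bits" where
  "interleave (p, (s, (r, u), v), t) n = ([p, s, r, u, v, t] ! (n mod 6)) (n div 6)"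

definition deinterleave :: "bits \<Rightarrow> point" where
  "deinterleave x = (\<lambda>i. x (6 * i), (\<lambda>i. x (6 * i + 1), (\<lambda>i. x (6 * i + 2), \<lambda>i. x (6 * i + 3)),
     \<lambda>i. x (6 * i + 4)), \<lambda>i. x (6 * i + 5))"

lemma mod_6_cases:
  obtains i j :: nat where "n = 6 * i + j" "j \<in> {0, 1, 2, 3, 4, 5}"
proof
  show "n = 6 * (n div 6) + n mod 6" by simp
  show "n mod 6 \<in> {0, 1, 2, 3, 4, 5}" using mod_less_divisor[of 6 n] by auto
qed

lemma interleave_nth:
  "j < 6 \<Longrightarrow> interleave (p, (s, (r, u), v), t) (6 * i + j) = ([p, s, r, u, v, t] ! j) i"
  by simp

lemma deinterleave_interleave: "deinterleave (interleave \<omega>) = \<omega>"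
proof -
  obtain p s r u v t where fields: "\<omega> = (p, (s, (r, u), v), t)" by (metis surj_pair)
  have *: "(\<lambda>i. interleave \<omega> (6 * i + j)) = [p, s, r, u, v, t] ! j" if "j < 6" for j
    using that by (simp only: fields interleave_nth)
  show ?thesis
    using *[of 0] *[of 1] *[of 2] *[of 3] *[of 4] *[of 5] by (simp add: deinterleave_def fields)
qed

lemma interleave_deinterleave: "interleave (deinterleave x) = x"
proof
  fix n show "interleave (deinterleave x) n = x n"
  proof (cases n rule: mod_6_cases)
    case (1 i j)
    then have "j < 6" by auto
    then show ?thesis
      using 1(2) unfolding 1(1) deinterleave_def interleave_nth[OF \<open>j < 6\<close>] by auto
  qed
qed

definition bits_act :: "_ \<Rightarrow> bits \<Rightarrow> bits" where
  "bits_act g = interleave \<circ> rho2 g \<circ> deinterleave"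

text \<open>A block consists of one letter from each of the six coordinates.\<close>

definition block_step :: "('q \<Rightarrow> bool list \<Rightarrow> 'q) \<Rightarrow> bool list \<times> 'q \<Rightarrow> bool \<Rightarrow> bool list \<times> 'q" where
  "block_step \<delta> = (\<lambda>(w, q) b. if length w = 5 then ([], \<delta> q (w @ [b])) else (w @ [b], q))"

fun core_state :: "('q \<Rightarrow> bool list \<Rightarrow> 'q) \<Rightarrow> 'q \<Rightarrow> bits \<Rightarrow> nat \<Rightarrow> 'q" where
  "core_state \<delta> q x 0 = q"
| "core_state \<delta> q x (Suc i) = \<delta> (core_state \<delta> q x i) (map (\<lambda>k. x (6 * i + k)) [0..<6])"

text \<open>The list component buffers the letters of the current block, and the core state changes
  only when the sixth letter arrives. Reading inside one block is the auxiliary fact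
  \<open>step\<close>.\<close>

lemma run_state_block:
  "j < 6 \<Longrightarrow> run_state (block_step \<delta>) ([], q) x (6 * i + j)
     = (map (\<lambda>k. x (6 * i + k)) [0..<j], core_state \<delta> q x i)"
proof (induction i arbitrary: j)
  have step: "run_state (block_step \<delta>) ([], q) x (6 * i + j) = (map (\<lambda>k. x (6 * i + k)) [0..<j], c)"
    if "run_state (block_step \<delta>) ([], q) x (6 * i) = ([], c)" "j < 6" for i j c
    using that(2)
    by (induction j) (use that(1) in \<open>auto simp: block_step_def\<close>)
  {
    case 0
    then show ?case using step[of 0 q j] by simp
  next
    case (Suc i)
    have "run_state (block_step \<delta>) ([], q) x (6 * Suc i)
        = block_step \<delta> (run_state (block_step \<delta>) ([], q) x (6 * i + 5)) (x (6 * i + 5))"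
      using run_state.simps(2)[of "block_step \<delta>" "([], q)" x "6 * i + 5"] by (simp add: eval_nat_numeral)
    also have "\<dots> = ([], core_state \<delta> q x (Suc i))"
      using Suc.IH[of 5] by (simp add: block_step_def eval_nat_numeral)
    finally show ?case using step Suc.prems by blast
  }
qed

lemma block_machine_in_FA:
  fixes q :: "'q::finite"
  shows "tree (run (block_step \<delta>) flip ([], q)) \<in> carrier (FA 2)"
proof (rule tree_run_in_FA)
  show "finite ({w :: bool list. length w \<le> 5} \<times> (UNIV :: 'q set))"
    using finite_lists_length_le[of "UNIV :: bool set" 5] by simp
  show "run_state (block_step \<delta>) ([], q) x n \<in> {w. length w \<le> 5} \<times> UNIV" for x n
    by (induction n) (auto simp: block_step_def split: prod.splits)
qed

lemma block_machine_eqI: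
  assumes "\<And>x i j. j < 6 \<Longrightarrow> \<phi> x (6 * i + j) \<longleftrightarrow>
    x (6 * i + j) \<noteq> flip (map (\<lambda>k. x (6 * i + k)) [0..<j], core_state \<delta> q x i)"
  shows "\<phi> = run (block_step \<delta>) flip ([], q)"
proof (intro ext)
  fix x n show "\<phi> x n = run (block_step \<delta>) flip ([], q) x n"
  proof (cases n rule: mod_6_cases)
    case (1 i j)
    then have j: "j < 6" by auto
    show ?thesis unfolding 1(1) run_def run_state_block[OF j] by (rule assms[OF j])
  qed
qed

text \<open>The carry out of one place when digits \<open>a\<close> and \<open>b\<close> are added
  with incoming carry \<open>c\<close>.\<close>

definition majority :: "bool \<Rightarrow> bool \<Rightarrow> bool \<Rightarrow> bool" where
  "majority a b c \<longleftrightarrow> (a \<and> b) \<or> ((a \<or> b) \<and> c)"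

abbreviation "gen0 \<equiv> cursor (cursor (1::int))"
abbreviation "gen1 \<equiv> cursor (lamp integer_group)"
abbreviation "gen2 \<equiv> lamp (wreath integer_group integer_group)"

lemma rho2_gen0: "rho2 gen0 (p, (s, (r, u), v), t) = (p, (s, (r, pascal u), v), t)"
  by (simp add: rho2_def rho1_def rho0_def skew_cursor zpow_1 bij_pascal)

lemma rho2_gen1:
  "rho2 gen1 (p, (s, (r, u), v), t) = (p, (s, (r, u), translate (val (\<lambda>i. s i \<and> u i)) v), t)"
  by (simp add: rho2_def rho1_def skew_cursor group.skew_lamp[OF group_integer_group acts_rho0])

lemma rho2_gen2:
  "rho2 gen2 (p, x, t) = (p, x, translate (val (\<lambda>i. p i \<and> agree x i)) t)"
  unfolding rho2_def
  by (rule group.skew_lamp[OF group_wreath[OF group_integer_group group_integer_group] acts_rho1])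

lemma lt_6_cases: "j < 6 \<Longrightarrow> j \<in> {0, 1, 2, 3, 4, 5 :: nat}"
  by auto

text \<open>The core state remembers the letter of \<open>u\<close> from the preceding block; the
  initial \<open>False\<close> is the missing coefficient before place 0.\<close>

lemma bits_act_gen0:
  "bits_act gen0 = run (block_step (\<lambda>q w. w ! 3)) (\<lambda>(w, q). length w = 3 \<and> q) ([], False)"
proof (rule block_machine_eqI)
  fix x :: bits and i j :: nat
  assume j: "j < 6"
  have core: "core_state (\<lambda>q w. w ! 3) False x i \<longleftrightarrow> i > 0 \<and> x (6 * (i - 1) + 3)"
    by (cases i) auto
  have "pascal (\<lambda>i. x (6 * i + 3)) i \<longleftrightarrow> x (6 * i + 3) \<noteq> (i > 0 \<and> x (6 * (i - 1) + 3))"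
    by (cases i) (auto simp: pascal_0 pascal_Suc)
  then show "bits_act gen0 x (6 * i + j) \<longleftrightarrow> x (6 * i + j) \<noteq>
      (case (map (\<lambda>k. x (6 * i + k)) [0..<j], core_state (\<lambda>q w. w ! 3) False x i) of
        (w, q) \<Rightarrow> length w = 3 \<and> q)"
    using lt_6_cases[OF j]
    unfolding bits_act_def comp_apply deinterleave_def rho2_gen0 interleave_nth[OF j] core by auto
qed

text \<open>The core state is the carry in the addition of the masked \<open>u\<close> to
  \<open>v\<close>.\<close>

lemma bits_act_gen1:
  "bits_act gen1 = run (block_step (\<lambda>q w. majority (w ! 4) (w ! 1 \<and> w ! 3) q))
     (\<lambda>(w, q). length w = 4 \<and> (w ! 1 \<and> w ! 3) \<noteq> q) ([], False)"
proof (rule block_machine_eqI)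
  fix x :: bits and i j :: nat
  assume j: "j < 6"
  let ?v = "\<lambda>i. x (6 * i + 4)" and ?z = "\<lambda>i. x (6 * i + 1) \<and> x (6 * i + 3)"
  let ?core = "core_state (\<lambda>q w. majority (w ! 4) (w ! 1 \<and> w ! 3) q) False x"
  have core: "?core i \<longleftrightarrow> 2 ^ i \<le> val ?v i + val ?z i" for i
  proof (induction i)
    case 0
    show ?case by (simp add: val_def)
  next
    case (Suc i)
    then show ?case unfolding carry_Suc by (simp add: majority_def)
  qed
  show "bits_act gen1 x (6 * i + j) \<longleftrightarrow> x (6 * i + j) \<noteq>
      (case (map (\<lambda>k. x (6 * i + k)) [0..<j], ?core i) of
        (w, q) \<Rightarrow> length w = 4 \<and> (w ! 1 \<and> w ! 3) \<noteq> q)"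
    using lt_6_cases[OF j]
    unfolding bits_act_def comp_apply deinterleave_def rho2_gen1 interleave_nth[OF j] core
    by (auto simp: translate_val_carry)
qed

definition agree_step :: "bool \<Rightarrow> bool list \<Rightarrow> bool" where
  "agree_step a w \<longleftrightarrow> a \<and> w ! 3 = w ! 2 \<and> \<not> w ! 4"

text \<open>The core state pairs the digit of \<open>agree\<close> after the preceding block,
  initially true as an empty condition, with the carry. The current digit of \<open>agree\<close> is
  known before the letter of \<open>t\<close> is read.\<close>

lemma bits_act_gen2:
  "bits_act gen2 = run
     (block_step (\<lambda>(a, q) w. (agree_step a w, majority (w ! 5) (w ! 0 \<and> agree_step a w) q)))
     (\<lambda>(w, (a, q)). length w = 5 \<and> (w ! 0 \<and> agree_step a w) \<noteq> q) ([], (True, False))"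
proof (rule block_machine_eqI)
  fix x :: bits and i j :: nat
  assume j: "j < 6"
  define c where "c = agree (fst (snd (deinterleave x)))"
  let ?t = "\<lambda>i. x (6 * i + 5)" and ?z = "\<lambda>i. x (6 * i) \<and> c i"
  let ?core = "core_state (\<lambda>(a, q) w. (agree_step a w, majority (w ! 5) (w ! 0 \<and> agree_step a w) q))
     (True, False) x"
  have c: "(i > 0 \<longrightarrow> c (i - 1)) \<and> x (6 * i + 3) = x (6 * i + 2) \<and> \<not> x (6 * i + 4) \<longleftrightarrow> c i" for i
    by (cases i) (auto simp: c_def agree_def deinterleave_def le_Suc_eq)
  have core: "?core i = ((i > 0 \<longrightarrow> c (i - 1)), 2 ^ i \<le> val ?t i + val ?z i)" for i
  proof (induction i)
    case 0
    show ?case by (simp add: val_def)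
  next
    case (Suc i)
    have "agree_step (i > 0 \<longrightarrow> c (i - 1)) (map (\<lambda>k. x (6 * i + k)) [0..<6]) = c i"
      using c[of i] by (simp add: agree_step_def)
    then show ?case unfolding carry_Suc using Suc by (simp add: majority_def)
  qed
  have act: "bits_act gen2 x (6 * i + j) = (if j = 5 then translate (val ?z) ?t i else x (6 * i + j))"
    using lt_6_cases[OF j]
    unfolding bits_act_def comp_apply c_def deinterleave_def rho2_gen2 interleave_nth[OF j] by auto
  show "bits_act gen2 x (6 * i + j) \<longleftrightarrow> x (6 * i + j) \<noteq>
      (case (map (\<lambda>k. x (6 * i + k)) [0..<j], ?core i) of
        (w, (a, q)) \<Rightarrow> length w = 5 \<and> (w ! 0 \<and> agree_step a w) \<noteq> q)"
  proof (cases "j = 5")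
    case True
    \<comment> \<open>The buffer holds five letters here rather than six; \<open>agree_step\<close>
      inspects only places 2, 3 and 4.\<close>
    have "agree_step (i > 0 \<longrightarrow> c (i - 1)) (map (\<lambda>k. x (6 * i + k)) [0..<5]) = c i"
      using c[of i] by (simp add: agree_step_def)
    then show ?thesis unfolding act core by (simp add: True translate_val_carry)
  next
    case False
    then show ?thesis unfolding act core by simp
  qed
qed

section \<open>The embedding and the automata group\<close>

lemma group_W3: "group W3"
  unfolding W3_def by (intro group_wreath group_integer_group)

lemma generate_W3: "generate W3 {gen0, gen1, gen2} = carrier W3"
proof -
  interpret Z: group integer_group by (rule group_integer_group)
  let ?H = "wreath integer_group integer_group"
  interpret H: group ?H by (rule group_wreath[OF Z.is_group Z.is_group])
  have "{lamp integer_group, cursor 1} \<subseteq> carrier ?H"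
    using Z.lamp_in_carrier Z.cursor_in_carrier[of 1] by simp
  moreover have "generate ?H {lamp integer_group, cursor 1} = carrier ?H"
    using Z.generate_wreath[of "{1}"] generate_integer_group by simp
  ultimately show ?thesis
    using H.generate_wreath[of "{lamp integer_group, cursor 1}"] by (simp add: W3_def insert_commute)
qed

lemma bits_act_one: "bits_act \<one>\<^bsub>W3\<^esub> = id"
  using acts_rho2 by (auto simp: bits_act_def acts_def interleave_deinterleave)

lemma bits_act_mult:
  "g \<in> carrier W3 \<Longrightarrow> h \<in> carrier W3 \<Longrightarrow> bits_act (g \<otimes>\<^bsub>W3\<^esub> h) = bits_act g \<circ> bits_act h"
  using acts_rho2 by (auto simp: bits_act_def acts_def deinterleave_interleave)

lemma bits_act_faithful:
  assumes "g \<in> carrier W3" "bits_act g = id"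
  shows "g = \<one>\<^bsub>W3\<^esub>"
proof (rule rho2_faithful[OF assms(1)])
  show "rho2 g = id"
  proof
    fix \<omega>
    have "interleave (rho2 g \<omega>) = interleave \<omega>"
      using fun_cong[OF assms(2), of "interleave \<omega>"] by (simp add: bits_act_def deinterleave_interleave)
    then show "rho2 g \<omega> = id \<omega>" by (metis id_apply deinterleave_interleave)
  qed
qed

lemma tree_bits_act_gen:
  assumes "g \<in> {gen0, gen1, gen2}"
  shows "isometry (bits_act g)" "tree (bits_act g) \<in> carrier (FA 2)"
  using assms
  by (auto simp: bits_act_gen0 bits_act_gen1 bits_act_gen2 isometry_run block_machine_in_FA)

theorem theoremD:
  shows "(\<exists>h. h \<in> hom W3 (FA 2) \<and> inj_on h (carrier W3))
       \<and> (\<exists>G h. automata_group 2 G \<and> h \<in> hom W3 (FA 2) \<and> inj_on h (carrier W3)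
                 \<and> h ` carrier W3 \<subseteq> G)"
proof -
  interpret W3: group W3 by (rule group_W3)
  interpret FA: group "FA 2" by (rule group_FA)
  define h where "h = tree \<circ> bits_act"
  define gens where "gens = {gen0, gen1, gen2}"
  have gen: "generate W3 gens = carrier W3" and fin: "finite gens"
    using generate_W3 by (simp_all add: gens_def)
  have gens: "gens \<subseteq> carrier W3" unfolding gen[symmetric] by (rule subsetI) (rule generate.incl)
  have gen_iso: "isometry (bits_act g)" and gen_FA: "tree (bits_act g) \<in> carrier (FA 2)"
    if "g \<in> gens" for g
    using tree_bits_act_gen that unfolding gens_def by blast+
  \<comment> \<open>All states of the images of the three generators: a finite set, as these images
    are finite-state, and one closed under taking states.\<close>
  define S where "S = (\<Union>g\<in>gens. states 2 (h g))"
  have h_gen: "h g \<in> carrier (FA 2)" if "g \<in> gens" for g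
    using gen_FA[OF that] by (simp add: h_def)
  then have tree_aut: "tree_aut 2 (h g)" "finite (states 2 (h g))" if "g \<in> gens" for g
    using that by (auto simp: FA_simps finite_state_def)
  have S: "finite S" "S \<subseteq> carrier (FA 2)"
    unfolding S_def using fin tree_aut(2) states_subset_FA[OF h_gen] by (blast intro: finite_UN_I)+
  have closed: "states 2 \<alpha> \<subseteq> S" if "\<alpha> \<in> S" for \<alpha>
    using that states_states[OF tree_aut(1)] unfolding S_def by blast
  let ?G = "generate (FA 2) S"
  have G: "automata_group 2 ?G"
    using S closed by (rule automata_group_generate)
  have G_FA: "?G \<subseteq> carrier (FA 2)" using S(2) by (rule FA.generate_incl)
  have gen_S: "h g \<in> S" if "g \<in> gens" for g
  proof -
    have "h g \<in> states 2 (h g)" by (rule self_in_states[OF tree_aut(1)[OF that]])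
    then show ?thesis using that unfolding S_def by blast
  qed
  have h_mult: "h (a \<otimes>\<^bsub>W3\<^esub> b) = h a \<otimes>\<^bsub>FA 2\<^esub> h b"
    if "a \<in> carrier W3" "b \<in> carrier W3" "isometry (bits_act a)" "isometry (bits_act b)" for a b
    using that by (simp only: h_def comp_apply bits_act_mult tree_comp FA_simps)
  \<comment> \<open>Only the generators have explicit machines, and \<open>tree\<close> respects
    composition only for isometries. So being an isometry and landing in the group are proved
    together by induction on generation.\<close>
  have main: "isometry (bits_act g) \<and> h g \<in> ?G" if "g \<in> generate W3 gens" for g
    using that
  proof (induction rule: generate.induct)
    case one
    have "h \<one>\<^bsub>W3\<^esub> = \<one>\<^bsub>FA 2\<^esub>"
      by (simp only: h_def comp_apply bits_act_one tree_id FA_simps)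
    then show ?case using generate.one[of "FA 2" S] isometry_id by (simp only: bits_act_one)
  next
    case (incl g)
    then show ?case using gen_iso gen_S by (blast intro: generate.incl)
  next
    case (inv g)
    then have g: "g \<in> carrier W3" using gens by blast
    then have 1: "bits_act g \<circ> bits_act (inv\<^bsub>W3\<^esub> g) = id"
      using bits_act_mult[of g "inv\<^bsub>W3\<^esub> g"] by (simp add: bits_act_one)
    have iso: "isometry (bits_act g)" "isometry (bits_act (inv\<^bsub>W3\<^esub> g))"
      using gen_iso[OF inv] isometry_inv[OF _ 1] by auto
    then have "h g \<circ> h (inv\<^bsub>W3\<^esub> g) = id"
      using 1 by (simp add: h_def tree_id flip: tree_comp)
    moreover have "bij (h g)" using tree_aut(1)[OF inv] by (simp add: tree_aut_iff)
    \<comment> \<open>A right inverse of the bijection \<open>h g\<close> is its inverse, so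
      inverses of generators also map into the generated group.\<close>
    ultimately have "h (inv\<^bsub>W3\<^esub> g) = inv_into UNIV (h g)"
      by (metis bij_is_inj comp_assoc id_comp inv_o_cancel comp_id)
    then show ?case
      using iso generate.inv[OF gen_S[OF inv], of "FA 2"] inv_FA[OF h_gen[OF inv]] by simp
  next
    case (eng a b)
    then have ab: "a \<in> carrier W3" "b \<in> carrier W3" by (auto simp: gen)
    show ?case
      unfolding h_mult[OF ab conjunct1[OF eng.IH(1)] conjunct1[OF eng.IH(2)]] bits_act_mult[OF ab]
      using eng.IH by (blast intro: isometry_comp generate.eng)
  qed
  then have iso: "isometry (bits_act g)" and h_G: "h g \<in> ?G" if "g \<in> carrier W3" for g
    using that by (auto simp: gen)
  have "group_hom W3 (FA 2) h"
    using iso h_G G_FA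
    by (auto simp: group_hom_def group_hom_axioms_def W3.is_group FA.is_group hom_def h_mult)
  then interpret h: group_hom W3 "FA 2" h .
  have "g = \<one>\<^bsub>W3\<^esub>" if "g \<in> carrier W3" "h g = \<one>\<^bsub>FA 2\<^esub>" for g
  proof -
    have "tree (bits_act g) = tree id"
      using that(2) by (simp only: h_def comp_apply FA_simps tree_id)
    then have "bits_act g = id"
      using iso[OF that(1)] isometry_id inj_onD[OF inj_on_tree] by blast
    then show ?thesis using bits_act_faithful that(1) by blast
  qed
  then have "inj_on h (carrier W3)" by (simp add: h.inj_on_one_iff)
  then show ?thesis using h.homh G h_G by blast
qed

end
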